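(* Let $r\ge 1$ be an integer, let $\beta>-1$ and let $\alpha_1,\dots,\alpha_r>-1$ satisfy $\alpha_i-\alpha_j\notin\mathbb{Z}$ for all $i\ne j$. For $n\ge 1$ let $P_{n\vec 1}$ be the Jacobi-Piñeiro polynomial with parameters $\vec\alpha=(\alpha_1,\dots,\alpha_r)$ and $\beta$ and with multi-index $n\vec 1=(n,n,\dots,n)\in\mathbb{N}^r$, and let $0<x_{1,rn}<x_{2,rn}<\cdots<x_{rn,rn}<1$ be its zeros. Then for every continuous function $f$ on $[0,1]$ one has $$\lim_{n\to\infty}\frac{1}{rn}\sum_{k=1}^{rn} f(x_{k,rn})=\int_0^1 f(t)\,v_r(t)\,dt,$$ where the density $v_r$ on $[0,1]$ is given by means of a density $w_r$ on $[0,c_r]$ as $$v_r(x)=c_r\,w_r(c_r x),\qquad c_r=\frac{(r+1)^{r+1}}{r^r},$$ and, with the change of variables $$\hat x=c_r x=\hat x(\varphi)=\frac{\bigl(\sin (r+1)\varphi\bigr)^{r+1}}{\sin\varphi\,\bigl(\sin r\varphi\bigr)^r},\qquad 0<\varphi<\frac{\pi}{r+1},$$ the density $w_r$ is $$w_r(\hat x)=\frac{r+1}{\pi}\,\frac{1}{|\hat x'(\varphi)|}=\frac{r+1}{\pi\hat x}\,\frac{\sin\varphi\,\sin r\varphi\,\sin(r+1)\varphi}{(r+1)^2\sin^2 r\varphi-2r(r+1)\sin(r+1)\varphi\,\sin r\varphi\,\cos\varphi+r^2\sin^2(r+1)\varphi}.$$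
   Context: For a multi-index $\vec n=(n_1,\dots,n_r)\in\mathbb{N}^r$ write $|\vec n|=n_1+\cdots+n_r$. The Jacobi-Piñeiro polynomial $P_{\vec n}$ with parameters $\vec\alpha=(\alpha_1,\dots,\alpha_r)$ and $\beta$ is the monic polynomial of degree $|\vec n|$ satisfying $$\int_0^1 P_{\vec n}(x)\,x^k x^{\alpha_j}(1-x)^\beta\,dx=0,\qquad k=0,1,\dots,n_j-1,\quad j=1,2,\dots,r.$$ Under the assumptions $\beta>-1$, $\alpha_j>-1$ and $\alpha_i-\alpha_j\notin\mathbb{Z}$ for $i\neq j$, this polynomial exists and is unique for every multi-index, and its $|\vec n|$ zeros are simple and lie in $(0,1)$. The multi-index $n\vec 1$ is $(n,n,\dots,n)$, so $|n\vec 1|=rn$. The function $\varphi\mapsto\hat x(\varphi)$ is strictly decreasing from $(0,\frac{\pi}{r+1})$ onto $(0,c_r)$, so the formula for $w_r(\hat x)$ determines $w_r$ on $(0,c_r)$; $\hat x'(\varphi)$ denotes the derivative with respect to $\varphi$. The notation $\sin r\varphi$ means $\sin(r\varphi)$ and $\sin(r+1)\varphi$ means $\sin((r+1)\varphi)$. *)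

theory Defs
  imports "HOL-Analysis.Analysis" "HOL-Computational_Algebra.Polynomial"
begin

text \<open>
  Multi-indices and parameter vectors of length r are functions on the naturals of which only
  the values at 1, ..., r are used. The weight is integrable under the standing assumptions
  (all exponents larger than -1), so the Lebesgue integral below is a genuine one.
\<close>

definition jacobi_pineiro ::
    "nat \<Rightarrow> (nat \<Rightarrow> real) \<Rightarrow> real \<Rightarrow> (nat \<Rightarrow> nat) \<Rightarrow> real poly \<Rightarrow> bool" where
  "jacobi_pineiro r \<alpha> \<beta> n P \<longleftrightarrow>
     lead_coeff P = 1 \<and> degree P = (\<Sum>j=1..r. n j) \<and>
     (\<forall>j\<in>{1..r}. \<forall>k<n j.
        (LBINT x:{0..1}. poly P x * x ^ k * x powr \<alpha> j * (1 - x) powr \<beta>) = 0)"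

definition c_const :: "nat \<Rightarrow> real" where
  "c_const r = real (r + 1) ^ (r + 1) / real r ^ r"

definition xhat :: "nat \<Rightarrow> real \<Rightarrow> real" where
  "xhat r \<phi> = sin (real (r + 1) * \<phi>) ^ (r + 1) / (sin \<phi> * sin (real r * \<phi>) ^ r)"

text \<open>
  The map \<open>xhat r\<close> is a strictly decreasing bijection from the open interval from 0 to
  \<open>pi / (r + 1)\<close> onto the open interval from 0 to \<open>c_const r\<close>; only on the latter is the value of
  \<open>w_dens r\<close> meaningful.
\<close>

definition w_dens :: "nat \<Rightarrow> real \<Rightarrow> real" where
  "w_dens r y =
     (let \<phi> = the_inv_into {0<..<pi / real (r + 1)} (xhat r) y
      in real (r + 1) / pi * (1 / \<bar>deriv (xhat r) \<phi>\<bar>))"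

definition v_dens :: "nat \<Rightarrow> real \<Rightarrow> real" where
  "v_dens r x = c_const r * w_dens r (c_const r * x)"

end

theory Submission
  imports Defs "HOL-Complex_Analysis.Complex_Analysis" "HOL-Real_Asymp.Real_Asymp"
begin

text \<open>
  Write \<open>\<theta> = x d/dx\<close>, \<open>N = r n\<close>, and let \<open>x\<^sub>1, \<dots>, x\<^sub>N\<close> be the zeros of \<open>P = P n\<close>. The proof compares
  the averages of the kernels \<open>t \<mapsto> y / (y + t)\<close>, \<open>y\<close> large, over the zeros and against the density.

  \<^item> The moments \<open>\<integral> P(x) x\<^sup>s\<^sup>-\<^sup>1 (1 - x)\<^sup>\<beta> dx\<close> are, up to Gamma factors, a polynomial in \<open>s\<close> of degree at most
    \<open>N\<close>. Orthogonality prescribes \<open>N\<close> zeros of it, which are distinct because no difference of two of the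
    \<open>\<alpha>\<^sub>j\<close> is an integer, so it is known up to a constant (\<open>jacobi_pineiro_mellin\<close>). Its values at
    \<open>s = -k\<close> are, up to explicit factors, the Taylor coefficients of \<open>F = (1 - x)\<^sup>\<beta> P\<close>. These are
    therefore hypergeometric, that is, \<open>F\<close> satisfies
    \<open>\<theta> \<Prod>(\<theta> + \<alpha>\<^sub>j) F = x (\<theta> - \<beta> - N) \<Prod>(\<theta> + \<alpha>\<^sub>j + 1 + n) F\<close> (\<open>jacobi_pineiro_ode\<close>).

  \<^item> For \<open>x < 0\<close> put \<open>h = x P' / (n P) = (1/n) \<Sum> x / (x - x\<^sub>k)\<close>. This lies in \<open>[0, r]\<close>, and each of its
    \<open>\<theta>\<close>-derivatives is bounded uniformly in \<open>n\<close>, so that \<open>\<theta> / n\<close> acts on \<open>F\<close> like multiplication by \<open>h\<close> up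
    to \<open>O(1/n)\<close>. The differential equation becomes \<open>h\<^sup>r\<^sup>+\<^sup>1 = x (h - r) (h + 1)\<^sup>r + O(1/n)\<close>. This equation
    has exactly one nonnegative solution \<open>H\<close>, and it depends stably on the error, so \<open>h\<close> converges to
    \<open>H\<close> (\<open>zero_kernel_limit\<close>). With \<open>c\<^sub>r x = w\<^sup>r\<^sup>+\<^sup>1 / (w - 1)\<close>, \<open>0 < w < 1\<close>, one has
    \<open>H = r w / (r + 1 - r w)\<close>.

  \<^item> The substitution \<open>c\<^sub>r t = xhat r \<phi>\<close> turns the density into the constant \<open>(r + 1) / \<pi>\<close> on
    \<open>(0, \<pi> / (r + 1))\<close> (\<open>v_dens_integral\<close>). On the curve
    \<open>v(\<phi>) = (sin \<phi> / sin r\<phi>) exp(i (r + 1) \<phi>)\<close> one has \<open>xhat r \<phi> = (1 + v)\<^sup>r\<^sup>+\<^sup>1 / v\<close>. The curve and its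
    mirror image form a loop around the origin, so the integral of a kernel is a residue
    (\<open>xhat_kernel_integral\<close>), and its value is \<open>H / r\<close>.

  \<^item> Hence averages converge for all kernels with large \<open>y\<close>. From these one obtains all monomials,
    by multiplying with \<open>t\<close> and letting \<open>y\<close> tend to infinity, and then all continuous functions by the
    Weierstrass theorem (\<open>mean_functionals_converge\<close>).
\<close>

section \<open>The Euler operator on power series\<close>

text \<open>
The Taylor series at 0 of \<open>(1 - x)\<^sup>\<gamma>\<close>.
\<close>

definition binom_fps :: "real \<Rightarrow> real fps" where
  "binom_fps \<gamma> = Abs_fps (\<lambda>k. pochhammer (- \<gamma>) k / fact k)"

text \<open>
  Chosen so that \<open>(\<theta> + c) ((1 - x)\<^sup>\<gamma> p) = (1 - x)\<^sup>\<gamma>\<^sup>-\<^sup>1 euler_step \<gamma> c p\<close>. Applying first order operators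
  \<open>\<theta> + c\<close> to \<open>(1 - x)\<^sup>\<beta> p\<close> thus stays within polynomials, and identities found from the Taylor series at 0
  can be used at every point of the real line, also where that series diverges.
\<close>

definition euler_step :: "real \<Rightarrow> real \<Rightarrow> real poly \<Rightarrow> real poly" where
  "euler_step \<gamma> c p = [:0, 1:] * [:1, -1:] * pderiv p - smult \<gamma> ([:0, 1:] * p) + smult c ([:1, -1:] * p)"

primrec euler_iter :: "real \<Rightarrow> real list \<Rightarrow> real poly \<Rightarrow> real poly" where
  "euler_iter \<beta> [] p = p"
| "euler_iter \<beta> (c # cs) p = euler_step (\<beta> - length cs) c (euler_iter \<beta> cs p)"

text \<open>
Pascal's rule, in the form \<open>(1 - x) (1 - x)\<^sup>\<gamma>\<^sup>-\<^sup>1 = (1 - x)\<^sup>\<gamma>\<close>.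
\<close>

lemma binom_fps_step: "(1 - fps_X) * binom_fps (\<gamma> - 1) = binom_fps \<gamma>"
proof (rule fps_ext)
  fix k
  show "fps_nth ((1 - fps_X) * binom_fps (\<gamma> - 1)) k = fps_nth (binom_fps \<gamma>) k"
  proof (cases k)
    case 0 then show ?thesis by (simp add: binom_fps_def)
  next
    case (Suc m)
    have "(1 - fps_X) * binom_fps (\<gamma> - 1) = binom_fps (\<gamma> - 1) - fps_X * binom_fps (\<gamma> - 1)"
      by (simp add: algebra_simps)
    then have "fps_nth ((1 - fps_X) * binom_fps (\<gamma> - 1)) k
        = pochhammer (1 - \<gamma>) (Suc m) / fact (Suc m) - pochhammer (1 - \<gamma>) m / fact m"
      using Suc by (simp add: binom_fps_def)
    also have "\<dots> = pochhammer (1 - \<gamma>) m * (- \<gamma>) / fact (Suc m)"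
      unfolding pochhammer_Suc fact_Suc by (simp add: divide_simps) (simp add: algebra_simps)
    also have "\<dots> = pochhammer (- \<gamma>) (Suc m) / fact (Suc m)"
      unfolding pochhammer_rec by simp
    finally show ?thesis using Suc by (simp add: binom_fps_def)
  qed
qed

lemma fps_deriv_binom_fps: "fps_deriv (binom_fps \<gamma>) = fps_const (- \<gamma>) * binom_fps (\<gamma> - 1)"
proof (rule fps_ext)
  fix k
  have "fps_nth (fps_deriv (binom_fps \<gamma>)) k = real (Suc k) * (pochhammer (-\<gamma>) (Suc k) / fact (Suc k))"
    by (simp add: binom_fps_def)
  also have "\<dots> = pochhammer (-\<gamma>) (Suc k) / fact k"
    unfolding fact_Suc by (simp add: divide_simps)
  also have "\<dots> = - \<gamma> * pochhammer (1 - \<gamma>) k / fact k"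
    unfolding pochhammer_rec by simp
  finally show "fps_nth (fps_deriv (binom_fps \<gamma>)) k = fps_nth (fps_const (- \<gamma>) * binom_fps (\<gamma> - 1)) k"
    by (simp add: binom_fps_def)
qed

lemma euler_step_fps:
  "fps_of_poly (euler_step \<gamma> c p) * binom_fps (\<gamma> - 1)
     = fps_X * fps_deriv (fps_of_poly p * binom_fps \<gamma>) + fps_const c * (fps_of_poly p * binom_fps \<gamma>)"
proof -
  have X: "fps_of_poly [:0, 1:] = (fps_X :: real fps)" "fps_of_poly [:1, -1:] = (1 - fps_X :: real fps)"
    by (simp_all add: fps_of_poly_pCons)
  have *: "fps_of_poly (euler_step \<gamma> c p)
     = fps_X * (1 - fps_X) * fps_deriv (fps_of_poly p) - fps_const \<gamma> * (fps_X * fps_of_poly p)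
       + fps_const c * ((1 - fps_X) * fps_of_poly p)"
    unfolding euler_step_def
    by (simp only: fps_of_poly_add fps_of_poly_diff fps_of_poly_mult X fps_of_poly_smult fps_of_poly_pderiv)
  have c: "fps_const (- \<gamma>) = - fps_const \<gamma>" by simp
  show ?thesis
    unfolding * fps_deriv_mult fps_deriv_binom_fps
    unfolding binom_fps_step[of \<gamma>, symmetric] c
    by algebra
qed

text \<open>
  The operator \<open>\<theta> + c\<close> multiplies the coefficient of \<open>x\<^sup>k\<close> by \<open>k + c\<close>; iterated operators therefore act
  diagonally on Taylor coefficients.
\<close>

lemma euler_iter_fps_nth:
  "fps_nth (fps_of_poly (euler_iter \<beta> cs p) * binom_fps (\<beta> - length cs)) k
     = (\<Prod>c\<leftarrow>cs. real k + c) * fps_nth (fps_of_poly p * binom_fps \<beta>) k"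
proof (induction cs)
  case (Cons c cs)
  have e: "\<beta> - real (length (c # cs)) = (\<beta> - length cs) - 1" by simp
  have m: "fps_nth (fps_X * fps_deriv G) k = real k * fps_nth G k" for G :: "real fps"
    by (cases k) auto
  show ?case
    unfolding e euler_iter.simps euler_step_fps fps_add_nth m fps_mult_left_const_nth Cons
    by (simp add: distrib_right)
qed simp

section \<open>The Mellin transform of a polynomial against a Jacobi weight\<close>

lemma degree_pochhammer_linear: "degree (pochhammer [:a, 1::real:] k) \<le> k"
proof (induction k)
  case (Suc k)
  have "degree ([:a, 1::real:] + of_nat k) \<le> 1"
    by (simp add: of_nat_poly)
  then show ?case
    using Suc degree_mult_le[of "pochhammer [:a, 1:] k" "[:a, 1::real:] + of_nat k"]
    by (simp add: pochhammer_Suc)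
qed simp

lemma poly_pochhammer_linear: "poly (pochhammer [:a, 1::real:] k) s = pochhammer (s + a) k"
  by (induction k) (simp_all add: pochhammer_Suc of_nat_poly algebra_simps)

text \<open>
  The polynomial factor of \<open>\<integral> p(x) x\<^sup>s\<^sup>-\<^sup>1 (1 - x)\<^sup>\<beta> dx\<close> over \<open>[0, 1]\<close>, for \<open>p\<close> of degree at most \<open>N\<close>:
  what is left after division by \<open>\<Gamma>(s) \<Gamma>(\<beta> + 1) / \<Gamma>(s + \<beta> + 1 + N)\<close>.
\<close>

definition mellin_poly :: "real \<Rightarrow> nat \<Rightarrow> real poly \<Rightarrow> real poly" where
  "mellin_poly \<beta> N p =
     (\<Sum>i\<le>N. smult (coeff p i) (pochhammer [:0, 1:] i * pochhammer [:\<beta> + 1 + real i, 1:] (N - i)))"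

lemma degree_mellin_poly: "degree (mellin_poly \<beta> N p) \<le> N"
  unfolding mellin_poly_def
proof (rule degree_sum_le)
  fix i assume i: "i \<in> {..N}"
  let ?A = "pochhammer [:0, 1::real:] i" and ?B = "pochhammer [:\<beta> + 1 + real i, 1:] (N - i)"
  have "degree (?A * ?B) \<le> degree ?A + degree ?B" by (rule degree_mult_le)
  also have "\<dots> \<le> i + (N - i)"
    by (intro add_mono degree_pochhammer_linear)
  finally have "degree (?A * ?B) \<le> N" using i by simp
  then show "degree (smult (coeff p i) (?A * ?B)) \<le> N"
    using degree_smult_le le_trans by blast
qed simp

lemma poly_mellin_poly:
  "poly (mellin_poly \<beta> N p) s = (\<Sum>i\<le>N. coeff p i * (pochhammer s i * pochhammer (s + \<beta> + 1 + real i) (N - i)))"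
  by (simp add: mellin_poly_def poly_sum poly_pochhammer_linear algebra_simps)

lemma beta_lborel:
  fixes a b :: real
  assumes "a > 0" "b > 0"
  shows "set_integrable lborel {0..1} (\<lambda>t. t powr (a - 1) * (1 - t) powr (b - 1))"
    and "(LBINT t:{0..1}. t powr (a - 1) * (1 - t) powr (b - 1)) = Beta a b"
proof -
  let ?f = "\<lambda>t. t powr (a - 1) * (1 - t) powr (b - 1)"
  have I: "(?f has_integral Beta a b) {0..1}"
    by (rule has_integral_Beta_real) (use assms in auto)
  then have "?f absolutely_integrable_on {0..1}"
    by (intro nonnegative_absolutely_integrable_1) (auto simp: integrable_on_def)
  then show *: "set_integrable lborel {0..1} ?f"
    unfolding set_integrable_def by (subst (asm) integrable_completion) auto
  show "(LBINT t:{0..1}. ?f t) = Beta a b"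
    using set_borel_integral_eq_integral(2)[OF *] I by (simp add: integral_unique)
qed

text \<open>
  All the Beta integrals of the monomials are brought to the same Gamma quotient, which makes
  the Mellin transform a multiple of a polynomial.
\<close>

lemma Beta_shift:
  fixes s b :: real
  assumes "s > 0" "b > 0" "i \<le> N"
  shows "Beta (s + real i) b
    = Gamma s * Gamma b / Gamma (s + b + real N) * (pochhammer s i * pochhammer (s + b + real i) (N - i))"
proof -
  have np: "z \<notin> \<int>\<^sub>\<le>\<^sub>0" if "z > 0" for z :: real
    using that by (auto elim!: nonpos_Ints_cases)
  have 1: "Gamma (s + real i) = pochhammer s i * Gamma s"
    using pochhammer_Gamma[OF np[OF assms(1)], of i] Gamma_real_pos[OF assms(1)] by simp
  have p: "s + b + real i > 0" using assms by simp
  have "pochhammer (s + b + real i) (N - i) = Gamma (s + b + real i + real (N - i)) / Gamma (s + b + real i)"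
    by (rule pochhammer_Gamma[OF np[OF p]])
  also have "s + b + real i + real (N - i) = s + b + real N" using assms by (simp add: of_nat_diff)
  finally have 2: "pochhammer (s + b + real i) (N - i) = Gamma (s + b + real N) / Gamma (s + b + real i)" .
  have "Gamma (s + b + real N) > 0" by (rule Gamma_real_pos) (use assms in simp)
  then show ?thesis
    unfolding Beta_def 1 2 by (simp add: add_ac)
qed

lemma beta_integral_poly:
  assumes "s > 0" "\<beta> > -1" "degree p \<le> N"
  shows "(LBINT x:{0..1}. poly p x * x powr (s - 1) * (1 - x) powr \<beta>)
     = Gamma s * Gamma (\<beta> + 1) / Gamma (s + \<beta> + 1 + real N) * poly (mellin_poly \<beta> N p) s"
proof -
  have b: "\<beta> + 1 > 0" using assms by simp
  have si: "s + real i > 0" for i using assms by simp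
  have eq: "poly p x * x powr (s - 1) * (1 - x) powr \<beta>
     = (\<Sum>i\<le>N. coeff p i * (x powr (s + real i - 1) * (1 - x) powr (\<beta> + 1 - 1)))" if "x \<in> {0..1}" for x
  proof (cases "x = 0")
    case False
    then have x: "x > 0" using that by simp
    have "poly p x = (\<Sum>i\<le>N. coeff p i * x ^ i)"
      unfolding poly_altdef using assms
      by (intro sum.mono_neutral_left) (auto simp: coeff_eq_0)
    moreover have "x powr (s + real i - 1) = x ^ i * x powr (s - 1)" for i
      using x by (simp add: powr_realpow[symmetric] powr_add[symmetric] algebra_simps)
    ultimately show ?thesis by (simp add: sum_distrib_left sum_distrib_right mult_ac)
  qed simp
  have "(LBINT x:{0..1}. poly p x * x powr (s - 1) * (1 - x) powr \<beta>)
      = (LBINT x:{0..1}. (\<Sum>i\<le>N. coeff p i * (x powr (s + real i - 1) * (1 - x) powr (\<beta> + 1 - 1))))"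
    by (intro set_lebesgue_integral_cong) (use eq in auto)
  also have "\<dots> = (\<Sum>i\<le>N. (LBINT x:{0..1}. coeff p i * (x powr (s + real i - 1) * (1 - x) powr (\<beta> + 1 - 1))))"
    unfolding set_lebesgue_integral_def scaleR_sum_right
    by (intro Bochner_Integration.integral_sum)
      (use set_integrable_mult_right[OF beta_lborel(1)[OF si b]] in \<open>auto simp: set_integrable_def\<close>)
  also have "\<dots> = (\<Sum>i\<le>N. coeff p i * Beta (s + real i) (\<beta> + 1))"
    by (simp only: set_integral_mult_right beta_lborel(2)[OF si b])
  also have "\<dots> = (\<Sum>i\<le>N. coeff p i * (Gamma s * Gamma (\<beta> + 1) / Gamma (s + \<beta> + 1 + real N)
       * (pochhammer s i * pochhammer (s + \<beta> + 1 + real i) (N - i))))"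
    by (intro sum.cong refl) (use Beta_shift[OF assms(1) b] in \<open>simp add: add_ac\<close>)
  also have "\<dots> = Gamma s * Gamma (\<beta> + 1) / Gamma (s + \<beta> + 1 + real N) * poly (mellin_poly \<beta> N p) s"
    unfolding poly_mellin_poly sum_distrib_left by (simp add: mult_ac)
  finally show ?thesis .
qed

text \<open>
  Both sides rest on the two ways of splitting
  \<open>pochhammer (-\<beta> - N) (N + (k - i)) = pochhammer (-\<beta> - N) (k + (N - i))\<close>.
\<close>

lemma binom_mellin_term:
  fixes \<beta> :: real
  assumes "i \<le> k" "i \<le> N"
  shows "pochhammer (- \<beta>) (k - i) / fact (k - i) * ((- 1) ^ N * pochhammer (- \<beta> - real N) N * fact k)
    = pochhammer (- real k) i * pochhammer (- real k + \<beta> + 1 + real i) (N - i) * pochhammer (- \<beta> - real N) k"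
proof -
  have 1: "pochhammer (- real k) i = (- 1) ^ i * (fact k / fact (k - i))"
  proof -
    have "pochhammer (- real k) i = (- 1) ^ i * pochhammer (1 + real (k - i)) i"
      using pochhammer_minus[of "real k" i] assms(1) by (simp add: of_nat_diff algebra_simps)
    moreover have "fact k = fact (k - i) * pochhammer (1 + real (k - i)) i"
      unfolding pochhammer_fact using assms(1) by (subst pochhammer_product[of "k - i" k]) simp_all
    ultimately show ?thesis by simp
  qed
  have 2: "pochhammer (- real k + \<beta> + 1 + real i) (N - i) = (- 1) ^ (N - i) * pochhammer (- \<beta> - real N + real k) (N - i)"
    using pochhammer_minus[of "real k - \<beta> - 1 - real i" "N - i"] assms(2) by (simp add: of_nat_diff algebra_simps)
  have s: "(- 1 :: real) ^ i * (- 1) ^ (N - i) = (- 1) ^ N"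
    using assms(2) by (simp add: power_add[symmetric])
  have "pochhammer (- \<beta> - real N) N * pochhammer (- \<beta>) (k - i) = pochhammer (- \<beta> - real N) (N + (k - i))"
    unfolding pochhammer_product' by simp
  also have "N + (k - i) = k + (N - i)" using assms by simp
  also have "pochhammer (- \<beta> - real N) \<dots> = pochhammer (- \<beta> - real N) k * pochhammer (- \<beta> - real N + real k) (N - i)"
    by (rule pochhammer_product')
  finally have 3: "pochhammer (- \<beta> - real N) N * pochhammer (- \<beta>) (k - i)
      = pochhammer (- \<beta> - real N) k * pochhammer (- \<beta> - real N + real k) (N - i)" .
  have "pochhammer (- \<beta>) (k - i) / fact (k - i) * ((- 1) ^ N * pochhammer (- \<beta> - real N) N * fact k)
      = (- 1) ^ N * (fact k / fact (k - i)) * (pochhammer (- \<beta> - real N) N * pochhammer (- \<beta>) (k - i))"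
    by simp
  then show ?thesis unfolding 3 1 2 s[symmetric] by (simp only: mult_ac)
qed

text \<open>
  The link between integrals and power series: the values of the Mellin polynomial at the
  nonpositive integers are, up to explicit factors, the Taylor coefficients of \<open>(1 - x)\<^sup>\<beta> p\<close>.
\<close>

lemma fps_nth_binom_mellin:
  assumes "degree p \<le> N"
  shows "fps_nth (fps_of_poly p * binom_fps \<beta>) k * ((- 1) ^ N * pochhammer (- \<beta> - real N) N * fact k)
    = poly (mellin_poly \<beta> N p) (- real k) * pochhammer (- \<beta> - real N) k"
proof -
  let ?c = "(- 1) ^ N * pochhammer (- \<beta> - real N) N * fact k"
  let ?t = "\<lambda>i. coeff p i * (pochhammer (- real k) i * pochhammer (- real k + \<beta> + 1 + real i) (N - i))"
  have "fps_nth (fps_of_poly p * binom_fps \<beta>) k * ?c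
      = (\<Sum>i\<le>k. coeff p i * (pochhammer (- \<beta>) (k - i) / fact (k - i) * ?c))"
    by (simp add: fps_mult_nth binom_fps_def sum_distrib_left sum_distrib_right atMost_atLeast0 mult_ac)
  also have "\<dots> = (\<Sum>i\<le>k. ?t i * pochhammer (- \<beta> - real N) k)"
  proof (intro sum.cong refl)
    fix i assume "i \<in> {..k}"
    then show "coeff p i * (pochhammer (- \<beta>) (k - i) / fact (k - i) * ?c) = ?t i * pochhammer (- \<beta> - real N) k"
      using assms binom_mellin_term[of i k N \<beta>]
      by (cases "i \<le> N") (simp_all add: coeff_eq_0)
  qed
  also have "\<dots> = (\<Sum>i\<in>{..k} \<inter> {..N}. ?t i * pochhammer (- \<beta> - real N) k)"
    using assms by (intro sum.mono_neutral_right) (auto simp: coeff_eq_0)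
  also have "\<dots> = (\<Sum>i\<le>N. ?t i * pochhammer (- \<beta> - real N) k)"
    by (intro sum.mono_neutral_left) (auto simp: pochhammer_of_nat_eq_0_lemma)
  finally show ?thesis by (simp add: poly_mellin_poly sum_distrib_right)
qed

section \<open>The differential equation of Jacobi-Pineiro polynomials\<close>

lemma poly_eq_smult_of_roots:
  fixes q p :: "real poly"
  assumes "degree q \<le> N" "degree p = N" "lead_coeff p = 1"
    and S: "finite S" "card S = N" "\<And>s. s \<in> S \<Longrightarrow> poly q s = 0" "\<And>s. s \<in> S \<Longrightarrow> poly p s = 0"
  shows "q = smult (coeff q N) p"
proof (rule ccontr)
  assume ne: "q \<noteq> smult (coeff q N) p"
  let ?d = "q - smult (coeff q N) p"
  have d: "?d \<noteq> 0" using ne by simp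
  have "coeff ?d N = 0" using assms by simp
  moreover have "degree ?d \<le> N"
    using assms degree_smult_le[of "coeff q N" p] by (intro degree_diff_le) auto
  ultimately have "degree ?d < N"
    using d by (metis leading_coeff_0_iff le_neq_implies_less)
  moreover have "S \<subseteq> {s. poly ?d s = 0}" using S by auto
  then have "N \<le> card {s. poly ?d s = 0}"
    using S poly_roots_finite[OF d] card_mono by blast
  moreover have "card {s. poly ?d s = 0} \<le> degree ?d"
    by (rule card_poly_roots_bound[OF d])
  ultimately show False by simp
qed

text \<open>
  Each orthogonality condition makes the Mellin polynomial vanish at \<open>s = \<alpha>\<^sub>j + k + 1\<close>. By the
  non-integrality of the differences these are \<open>r n\<close> distinct points, as many as the degree allows.
\<close>

lemma jacobi_pineiro_mellin:
  fixes \<alpha> :: "nat \<Rightarrow> real"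
  assumes b: "\<beta> > -1" and a: "\<And>j. j \<in> {1..r} \<Longrightarrow> \<alpha> j > -1"
    and ij: "\<And>i j. i \<in> {1..r} \<Longrightarrow> j \<in> {1..r} \<Longrightarrow> i \<noteq> j \<Longrightarrow> \<alpha> i - \<alpha> j \<notin> \<int>"
    and P: "jacobi_pineiro r \<alpha> \<beta> (\<lambda>_. n) P"
  obtains C where "\<And>s. poly (mellin_poly \<beta> (r * n) P) s = C * (\<Prod>j=1..r. pochhammer (s - \<alpha> j - real n) n)"
proof -
  let ?N = "r * n"
  have deg: "degree P = ?N" using P by (simp add: jacobi_pineiro_def)
  let ?q = "mellin_poly \<beta> ?N P"
  define rt where "rt = (\<lambda>(j, k). \<alpha> j + real k + 1)"
  let ?I = "{1..r} \<times> {..<n}"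
  have inj: "inj_on rt ?I"
  proof (rule inj_onI, clarify)
    fix i k j l assume *: "i \<in> {1..r}" "j \<in> {1..r}" "rt (i, k) = rt (j, l)"
    then have "\<alpha> i - \<alpha> j = of_int (int l - int k)" by (simp add: rt_def)
    then have "\<alpha> i - \<alpha> j \<in> \<int>" using Ints_of_int by metis
    then have "i = j" using ij * by blast
    then show "i = j \<and> k = l" using * by (simp add: rt_def)
  qed
  let ?p = "\<Prod>x\<in>?I. [:- rt x, 1:]"
  have z: "poly ?q (rt x) = 0" if "x \<in> ?I" for x
  proof -
    from that obtain j k where x: "x = (j, k)" "j \<in> {1..r}" "k < n" by blast
    let ?s = "\<alpha> j + real k + 1"
    have s: "?s > 0" using a[OF x(2)] by simp
    have "0 = (LBINT x:{0..1}. poly P x * x ^ k * x powr \<alpha> j * (1 - x) powr \<beta>)"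
      using P x by (simp add: jacobi_pineiro_def)
    also have "\<dots> = (LBINT x:{0..1}. poly P x * x powr (?s - 1) * (1 - x) powr \<beta>)"
    proof (intro set_lebesgue_integral_cong)
      show "\<forall>x. x \<in> {0..1} \<longrightarrow> poly P x * x ^ k * x powr \<alpha> j * (1 - x) powr \<beta> = poly P x * x powr (?s - 1) * (1 - x) powr \<beta>"
      proof (intro allI impI)
        fix x :: real assume "x \<in> {0..1}"
        then show "poly P x * x ^ k * x powr \<alpha> j * (1 - x) powr \<beta> = poly P x * x powr (?s - 1) * (1 - x) powr \<beta>"
          by (cases "x = 0") (auto simp: powr_add powr_realpow)
      qed
    qed simp
    also have "\<dots> = Gamma ?s * Gamma (\<beta> + 1) / Gamma (?s + \<beta> + 1 + real ?N) * poly ?q ?s"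
      by (rule beta_integral_poly[OF s b]) (simp add: deg)
    finally have e: "Gamma ?s * Gamma (\<beta> + 1) / Gamma (?s + \<beta> + 1 + real ?N) * poly ?q ?s = 0" by simp
    have "Gamma ?s > 0" "Gamma (\<beta> + 1) > 0" "Gamma (?s + \<beta> + 1 + real ?N) > 0"
      by (intro Gamma_real_pos; use s b in \<open>simp add: add_pos_nonneg\<close>)+
    then show ?thesis using e by (simp add: x rt_def)
  qed
  have qeq: "?q = smult (coeff ?q ?N) ?p"
  proof (rule poly_eq_smult_of_roots[where S = "rt ` ?I"])
    show "degree ?p = ?N" by (subst degree_prod_eq_sum_degree) auto
    show "lead_coeff ?p = 1" by (simp add: lead_coeff_prod)
    show "card (rt ` ?I) = ?N" unfolding card_image[OF inj] by simp
    show "poly ?p s = 0" if "s \<in> rt ` ?I" for s using that by (auto simp: poly_prod intro!: bexI)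
  qed (use z degree_mellin_poly in auto)
  then have 1: "poly ?q s = coeff ?q ?N * (\<Prod>x\<in>?I. s - rt x)" for s
  proof -
    have "poly (smult (coeff ?q ?N) ?p) s = coeff ?q ?N * (\<Prod>x\<in>?I. s - rt x)"
      by (simp add: poly_prod)
    then show ?thesis by (simp only: qeq[symmetric])
  qed
  have 2: "(\<Prod>k<n. s - rt (j, k)) = pochhammer (s - \<alpha> j - real n) n" for s j
  proof -
    have "pochhammer (s - \<alpha> j - real n) n = (\<Prod>i<n. s - \<alpha> j - real n + real i)"
      by (simp add: pochhammer_prod lessThan_atLeast0)
    also have "\<dots> = (\<Prod>k<n. s - rt (j, k))"
      by (subst prod.nat_diff_reindex[symmetric]) (auto intro!: prod.cong simp: rt_def of_nat_diff)
    finally show ?thesis by simp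
  qed
  have "(\<Prod>x\<in>?I. s - rt x) = (\<Prod>j=1..r. pochhammer (s - \<alpha> j - real n) n)" for s
    unfolding 2[symmetric] by (simp add: prod.cartesian_product case_prod_eta)
  with 1 have "poly ?q s = coeff ?q ?N * (\<Prod>j=1..r. pochhammer (s - \<alpha> j - real n) n)" for s
    by simp
  then show ?thesis using that by blast
qed

text \<open>
  The hypergeometric differential equation of order \<open>r + 1\<close>, with the factor \<open>(1 - x)\<^sup>\<beta>\<^sup>-\<^sup>r\<^sup>-\<^sup>1\<close> removed. It
  expresses the two-term recursion of the Taylor coefficients of \<open>(1 - x)\<^sup>\<beta> P\<close>, which follows from the
  product form of the Mellin polynomial at \<open>s = -k\<close>.
\<close>

lemma jacobi_pineiro_ode:
  fixes \<alpha> :: "nat \<Rightarrow> real"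
  assumes b: "\<beta> > -1" and a: "\<And>j. j \<in> {1..r} \<Longrightarrow> \<alpha> j > -1"
    and ij: "\<And>i j. i \<in> {1..r} \<Longrightarrow> j \<in> {1..r} \<Longrightarrow> i \<noteq> j \<Longrightarrow> \<alpha> i - \<alpha> j \<notin> \<int>"
    and P: "jacobi_pineiro r \<alpha> \<beta> (\<lambda>_. n) P"
  shows "euler_iter \<beta> (0 # map \<alpha> [1..<Suc r]) P
    = [:0, 1:] * euler_iter \<beta> ((- \<beta> - real (r * n)) # map (\<lambda>j. \<alpha> j + 1 + real n) [1..<Suc r]) P"
proof -
  let ?N = "r * n" and ?A = "fps_of_poly P * binom_fps \<beta>"
  let ?L = "0 # map \<alpha> [1..<Suc r]"
  let ?R = "(- \<beta> - real ?N) # map (\<lambda>j. \<alpha> j + 1 + real n) [1..<Suc r]"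
  have deg: "degree P = ?N" using P by (simp add: jacobi_pineiro_def)
  obtain C where C: "\<And>s. poly (mellin_poly \<beta> ?N P) s = C * (\<Prod>j=1..r. pochhammer (s - \<alpha> j - real n) n)"
    using jacobi_pineiro_mellin[OF b a ij P] by blast
  let ?K = "(- 1) ^ ?N * pochhammer (- \<beta> - real ?N) ?N"
  \<comment> \<open>As \<open>\<beta> > -1\<close>, every factor of the Pochhammer symbol is negative.\<close>
  have K: "?K \<noteq> 0"
  proof -
    have "- \<beta> - real ?N + real i \<noteq> 0" if "i < ?N" for i
    proof -
      have "real i + 1 \<le> real ?N" using that by linarith
      then show ?thesis using b by linarith
    qed
    then have "pochhammer (- \<beta> - real ?N) ?N \<noteq> 0"
      by (simp add: pochhammer_prod del: of_nat_mult)
    then show ?thesis by simp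
  qed
  define C' where "C' = C * (\<Prod>j=1..r. (-1)^n) / ?K"
  let ?b = "\<lambda>k. (\<Prod>j=1..r. pochhammer (real k + \<alpha> j + 1) n) * pochhammer (- \<beta> - real ?N) k / fact k"
  have A: "fps_nth ?A k = C' * ?b k" for k
  proof -
    have "pochhammer (- real k - \<alpha> j - real n) n = (-1)^n * pochhammer (real k + \<alpha> j + 1) n" for j
      using pochhammer_minus[of "real k + \<alpha> j + real n" n] by (simp add: algebra_simps)
    then have "poly (mellin_poly \<beta> ?N P) (- real k) = C * ((\<Prod>j=1..r. (-1)^n) * (\<Prod>j=1..r. pochhammer (real k + \<alpha> j + 1) n))"
      unfolding C prod.distrib[symmetric] by simp
    with fps_nth_binom_mellin[of P ?N \<beta> k] deg
    have "fps_nth ?A k * (?K * fact k) = C * ((\<Prod>j=1..r. (-1)^n) * (\<Prod>j=1..r. pochhammer (real k + \<alpha> j + 1) n)) * pochhammer (- \<beta> - real ?N) k"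
      by (simp only: mult.assoc order_refl)
    then have "fps_nth ?A k = C * ((\<Prod>j=1..r. (-1)^n) * (\<Prod>j=1..r. pochhammer (real k + \<alpha> j + 1) n)) * pochhammer (- \<beta> - real ?N) k / (?K * fact k)"
      using K by (subst eq_divide_eq) simp
    then show ?thesis unfolding C'_def by (simp only: times_divide_eq_left times_divide_eq_right divide_divide_eq_left mult_ac)
  qed
  have step: "(\<Prod>c\<leftarrow>?L. real (Suc k) + c) * fps_nth ?A (Suc k) = (\<Prod>c\<leftarrow>?R. real k + c) * fps_nth ?A k" for k
  proof -
    have pl: "(\<Prod>j\<leftarrow>[1..<Suc r]. f j) = (\<Prod>j=1..r. f j)" for f :: "nat \<Rightarrow> real"
      by (subst prod.distinct_set_conv_list[symmetric]) (simp_all add: atLeastLessThanSuc_atLeastAtMost del: upt_Suc)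
    have f: "(real (Suc k) + \<alpha> j) * pochhammer (real (Suc k) + \<alpha> j + 1) n
        = (real k + (\<alpha> j + 1 + real n)) * pochhammer (real k + \<alpha> j + 1) n" for j
      using pochhammer_rec[of "real (Suc k) + \<alpha> j" n] pochhammer_Suc[of "real (Suc k) + \<alpha> j" n]
      by (simp add: algebra_simps)
    have "(\<Prod>c\<leftarrow>?L. real (Suc k) + c) * ?b (Suc k)
      = real (Suc k) * (\<Prod>j=1..r. (real (Suc k) + \<alpha> j) * pochhammer (real (Suc k) + \<alpha> j + 1) n)
          * pochhammer (- \<beta> - real ?N) (Suc k) / fact (Suc k)"
      by (simp add: pl[unfolded One_nat_def] o_def prod.distrib del: upt_Suc of_nat_Suc fact_Suc)
    also have "\<dots> = (\<Prod>j=1..r. (real k + (\<alpha> j + 1 + real n)) * pochhammer (real k + \<alpha> j + 1) n)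
          * (pochhammer (- \<beta> - real ?N) k * (real k + (- \<beta> - real ?N))) / fact k"
      unfolding f pochhammer_Suc fact_Suc by (simp add: field_simps del: of_nat_Suc)
    also have "\<dots> = (\<Prod>c\<leftarrow>?R. real k + c) * ?b k"
      by (simp add: pl[unfolded One_nat_def] o_def prod.distrib del: upt_Suc of_nat_Suc fact_Suc)
    finally show ?thesis unfolding A by (simp only: mult.left_commute[of _ C'])
  qed
  have len: "length ?L = Suc r" "length ?R = Suc r" by simp_all
  have "fps_of_poly (euler_iter \<beta> ?L P) * binom_fps (\<beta> - real (Suc r))
      = fps_X * (fps_of_poly (euler_iter \<beta> ?R P) * binom_fps (\<beta> - real (Suc r)))"
  proof (rule fps_ext)
    fix k
    show "fps_nth (fps_of_poly (euler_iter \<beta> ?L P) * binom_fps (\<beta> - real (Suc r))) k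
      = fps_nth (fps_X * (fps_of_poly (euler_iter \<beta> ?R P) * binom_fps (\<beta> - real (Suc r)))) k"
    proof (cases k)
      case 0
      have "fps_nth (fps_of_poly (euler_iter \<beta> ?L P) * binom_fps (\<beta> - real (Suc r))) 0 = 0"
        by (subst euler_iter_fps_nth[of \<beta> ?L P, unfolded len]) simp
      then show ?thesis unfolding 0 by (simp only: fps_X_mult_nth) simp
    next
      case (Suc m)
      have "fps_nth (fps_of_poly (euler_iter \<beta> ?L P) * binom_fps (\<beta> - real (Suc r))) (Suc m)
          = fps_nth (fps_of_poly (euler_iter \<beta> ?R P) * binom_fps (\<beta> - real (Suc r))) m"
        unfolding euler_iter_fps_nth[of \<beta> ?L P, unfolded len] euler_iter_fps_nth[of \<beta> ?R P, unfolded len] by (rule step)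
      then show ?thesis unfolding Suc by (simp only: fps_X_mult_nth) simp
    qed
  qed
  then have "(fps_of_poly (euler_iter \<beta> ?L P) - fps_X * fps_of_poly (euler_iter \<beta> ?R P)) * binom_fps (\<beta> - real (Suc r)) = 0"
    by (simp only: left_diff_distrib mult.assoc) simp
  moreover have "binom_fps (\<beta> - real (Suc r)) \<noteq> 0"
  proof
    assume "binom_fps (\<beta> - real (Suc r)) = 0"
    then have "fps_nth (binom_fps (\<beta> - real (Suc r))) 0 = 0" by simp
    then show False by (simp add: binom_fps_def)
  qed
  ultimately have "fps_of_poly (euler_iter \<beta> ?L P) = fps_X * fps_of_poly (euler_iter \<beta> ?R P)"
    by simp
  also have "\<dots> = fps_of_poly ([:0, 1:] * euler_iter \<beta> ?R P)"
    by (simp add: fps_of_poly_mult fps_of_poly_pCons del: euler_iter.simps mult_pCons_left)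
  finally show ?thesis by (simp only: fps_of_poly_eq_iff)
qed

section \<open>Functions with uniformly bounded Euler derivatives\<close>

text \<open>
  \<open>theta_bounded m g\<close> bounds \<open>g\<close> and its first \<open>m\<close> derivatives with respect to \<open>\<theta>\<close> on the negative
  axis, uniformly in \<open>n\<close>. Counting the derivatives lets the product rule go through by induction, and
  an operator of order \<open>r + 1\<close> uses only finitely many of them.
\<close>

primrec theta_bounded :: "nat \<Rightarrow> (nat \<Rightarrow> real \<Rightarrow> real) \<Rightarrow> bool" where
  "theta_bounded 0 g \<longleftrightarrow> (\<exists>B. \<forall>n\<ge>1. \<forall>x<0. \<bar>g n x\<bar> \<le> B)"
| "theta_bounded (Suc m) g \<longleftrightarrow> (\<exists>B. \<forall>n\<ge>1. \<forall>x<0. \<bar>g n x\<bar> \<le> B) \<and>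
     (\<exists>g'. theta_bounded m g' \<and> (\<forall>n\<ge>1. \<forall>x<0. (g n has_field_derivative g' n x / x) (at x)))"

lemma theta_boundedD: "theta_bounded m g \<Longrightarrow> \<exists>B. \<forall>n\<ge>1. \<forall>x<0. \<bar>g n x\<bar> \<le> B"
  by (cases m) auto

lemma theta_bounded_0: "theta_bounded m g \<Longrightarrow> theta_bounded 0 g"
  using theta_boundedD by simp

lemma theta_bounded_SucD: "theta_bounded (Suc m) g \<Longrightarrow> theta_bounded m g"
proof (induction m arbitrary: g)
  case (Suc m)
  from Suc.prems obtain g' where g': "theta_bounded (Suc m) g'"
      "\<forall>n\<ge>1. \<forall>x<0. (g n has_field_derivative g' n x / x) (at x)"
    unfolding theta_bounded.simps(2)[of "Suc m"] by blast
  with Suc.IH[OF g'(1)] theta_boundedD[OF Suc.prems] show ?case by auto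
qed auto

lemma theta_bounded_cong:
  assumes "theta_bounded m f" "\<And>n x. n \<ge> 1 \<Longrightarrow> x < 0 \<Longrightarrow> f n x = g n x"
  shows "theta_bounded m g"
proof -
  have d: "(g n has_field_derivative D) (at x)"
    if "(f n has_field_derivative D) (at x)" "n \<ge> 1" "x < 0" for n D and x :: real
    by (rule has_field_derivative_transform_within_open[OF that(1), of "{..<0}"]) (use that assms(2) in auto)
  have "\<exists>B. \<forall>n\<ge>1. \<forall>x<0. \<bar>g n x\<bar> \<le> B"
    using theta_boundedD[OF assms(1)] by (simp add: assms(2))
  then show ?thesis
  proof (cases m)
    case (Suc m')
    from assms(1) obtain f' where "theta_bounded m' f'"
        "\<forall>n\<ge>1. \<forall>x<0. (f n has_field_derivative f' n x / x) (at x)"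
      unfolding Suc by auto
    then show ?thesis using d \<open>\<exists>B. _\<close> unfolding Suc theta_bounded.simps by blast
  qed simp
qed

lemma theta_bounded_const:
  assumes "\<And>n. n \<ge> 1 \<Longrightarrow> \<bar>k n\<bar> \<le> B"
  shows "theta_bounded m (\<lambda>n x. k n)"
proof -
  have z: "theta_bounded m (\<lambda>n x. 0)" for m
    by (induction m) (auto intro!: exI[of _ "\<lambda>n x. 0"])
  show ?thesis
  proof (cases m)
    case 0 then show ?thesis using assms by auto
  next
    case (Suc m')
    then show ?thesis using assms z[of m'] by (auto intro!: exI[of _ "\<lambda>n x. 0"])
  qed
qed

lemma theta_bounded_add:
  "theta_bounded m f \<Longrightarrow> theta_bounded m g \<Longrightarrow> theta_bounded m (\<lambda>n x. f n x + g n x)"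
proof (induction m arbitrary: f g)
  case 0
  then obtain A B where "\<forall>n\<ge>1. \<forall>x<0. \<bar>f n x\<bar> \<le> A" "\<forall>n\<ge>1. \<forall>x<0. \<bar>g n x\<bar> \<le> B" by auto
  then have "\<forall>n\<ge>1. \<forall>x<0. \<bar>f n x + g n x\<bar> \<le> A + B"
    by (blast intro: order_trans[OF abs_triangle_ineq] add_mono)
  then show ?case by auto
next
  case (Suc m)
  from Suc.prems obtain f' g' where d: "theta_bounded m f'" "theta_bounded m g'"
      "\<forall>n\<ge>1. \<forall>x<0. (f n has_field_derivative f' n x / x) (at x)"
      "\<forall>n\<ge>1. \<forall>x<0. (g n has_field_derivative g' n x / x) (at x)" by auto
  obtain A B where "\<forall>n\<ge>1. \<forall>x<0. \<bar>f n x\<bar> \<le> A" "\<forall>n\<ge>1. \<forall>x<0. \<bar>g n x\<bar> \<le> B"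
    using Suc.prems[THEN theta_boundedD] by blast
  then have b: "\<forall>n\<ge>1. \<forall>x<0. \<bar>f n x + g n x\<bar> \<le> A + B"
    by (blast intro: order_trans[OF abs_triangle_ineq] add_mono)
  have "\<forall>n\<ge>1. \<forall>x<0. ((\<lambda>x. f n x + g n x) has_field_derivative (f' n x + g' n x) / x) (at x)"
    using d by (auto intro!: derivative_eq_intros simp: add_divide_distrib)
  then show ?case using b Suc.IH[OF d(1,2)] by auto
qed

lemma abs_mult_le:
  fixes a b :: "'a :: linordered_idom"
  shows "\<bar>a\<bar> \<le> A \<Longrightarrow> \<bar>b\<bar> \<le> B \<Longrightarrow> \<bar>a * b\<bar> \<le> A * B"
  unfolding abs_mult by (rule mult_mono) (use abs_ge_zero order_trans in blast)+

lemma theta_bounded_mult: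
  "theta_bounded m f \<Longrightarrow> theta_bounded m g \<Longrightarrow> theta_bounded m (\<lambda>n x. f n x * g n x)"
proof (induction m arbitrary: f g)
  case 0
  then obtain A B where "\<forall>n\<ge>1. \<forall>x<0. \<bar>f n x\<bar> \<le> A" "\<forall>n\<ge>1. \<forall>x<0. \<bar>g n x\<bar> \<le> B" by auto
  then have "\<forall>n\<ge>1. \<forall>x<0. \<bar>f n x * g n x\<bar> \<le> A * B"
    by (blast intro: abs_mult_le)
  then show ?case by auto
next
  case (Suc m)
  from Suc.prems obtain f' g' where d: "theta_bounded m f'" "theta_bounded m g'"
      "\<forall>n\<ge>1. \<forall>x<0. (f n has_field_derivative f' n x / x) (at x)"
      "\<forall>n\<ge>1. \<forall>x<0. (g n has_field_derivative g' n x / x) (at x)" by auto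
  obtain A B where "\<forall>n\<ge>1. \<forall>x<0. \<bar>f n x\<bar> \<le> A" "\<forall>n\<ge>1. \<forall>x<0. \<bar>g n x\<bar> \<le> B"
    using Suc.prems[THEN theta_boundedD] by blast
  then have b: "\<forall>n\<ge>1. \<forall>x<0. \<bar>f n x * g n x\<bar> \<le> A * B"
    by (blast intro: abs_mult_le)
  have "\<forall>n\<ge>1. \<forall>x<0. ((\<lambda>x. f n x * g n x) has_field_derivative (f' n x * g n x + f n x * g' n x) / x) (at x)"
    using d by (auto intro!: derivative_eq_intros simp: add_divide_distrib)
  moreover have "theta_bounded m (\<lambda>n x. f' n x * g n x + f n x * g' n x)"
    by (intro theta_bounded_add Suc.IH d theta_bounded_SucD[OF Suc.prems(1)] theta_bounded_SucD[OF Suc.prems(2)])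
  ultimately show ?case using b by auto
qed

text \<open>
  For \<open>q = X\<close> and \<open>t n\<close> the zeros of \<open>P n\<close> this is \<open>x P' / (n P)\<close>. General \<open>q\<close> are admitted because the
  kernel \<open>s = x / (x - t)\<close> satisfies \<open>\<theta> s = s (1 - s)\<close>, so that this class is closed under \<open>\<theta>\<close>.
\<close>

definition kernel_avg :: "nat \<Rightarrow> (nat \<Rightarrow> nat \<Rightarrow> real) \<Rightarrow> real poly \<Rightarrow> nat \<Rightarrow> real \<Rightarrow> real" where
  "kernel_avg r t q n x = 1 / real n * (\<Sum>k=1..r * n. poly q (x / (x - t n k)))"

lemma kernel_bounds:
  fixes x t :: real
  assumes "x < 0" "t > 0"
  shows "0 < x / (x - t)" "x / (x - t) < 1"
  using assms by (auto simp: field_simps zero_less_divide_iff)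

lemma theta_bounded_kernel_avg:
  assumes t: "\<And>n k. n \<ge> 1 \<Longrightarrow> k \<in> {1..r * n} \<Longrightarrow> 0 < t n k"
  shows "theta_bounded m (kernel_avg r t q)"
proof (induction m arbitrary: q)
  have "\<exists>B. \<forall>s\<in>{0..1}. \<bar>poly q s\<bar> \<le> B" for q :: "real poly"
  proof -
    have "compact (poly q ` {0..1})"
      by (intro compact_continuous_image continuous_intros) auto
    then show ?thesis using compact_imp_bounded[of "poly q ` {0..1}"] by (auto simp: bounded_iff)
  qed
  then have "\<forall>q :: real poly. \<exists>B. \<forall>s\<in>{0..1}. \<bar>poly q s\<bar> \<le> B" by blast
  from choice[OF this] obtain B :: "real poly \<Rightarrow> real"
    where B: "\<And>q s. s \<in> {0..1} \<Longrightarrow> \<bar>poly q s\<bar> \<le> B q" by blast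
  have bd: "\<forall>n\<ge>1. \<forall>x<0. \<bar>kernel_avg r t q n x\<bar> \<le> real r * B q" for q
  proof (intro allI impI)
    fix n :: nat and x :: real assume n: "n \<ge> 1" and x: "x < 0"
    have "\<bar>\<Sum>k=1..r * n. poly q (x / (x - t n k))\<bar> \<le> (\<Sum>k=1..r * n. \<bar>poly q (x / (x - t n k))\<bar>)"
      by (rule sum_abs)
    also have "\<dots> \<le> real (card {1..r * n}) * B q"
    proof (rule sum_bounded_above)
      fix k assume k: "k \<in> {1..r * n}"
      show "\<bar>poly q (x / (x - t n k))\<bar> \<le> B q"
        by (rule B) (use kernel_bounds[OF x t[OF n k]] in simp)
    qed
    finally show "\<bar>kernel_avg r t q n x\<bar> \<le> real r * B q"
      using n by (simp add: kernel_avg_def abs_mult field_simps)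
  qed
  {
    case 0 show ?case using bd by auto
  next
    case (Suc m)
    have "(kernel_avg r t q n has_field_derivative kernel_avg r t (pderiv q * [:0, 1, -1:]) n x / x) (at x)"
      if n: "n \<ge> 1" and x: "x < 0" for n x
    proof -
      have "((\<lambda>x. 1 / real n * (\<Sum>k=1..r * n. poly q (x / (x - t n k)))) has_field_derivative
          1 / real n * (\<Sum>k=1..r * n. poly (pderiv q) (x / (x - t n k)) * ((x / (x - t n k)) * (1 - x / (x - t n k)) / x))) (at x)"
      proof (intro DERIV_cmult DERIV_sum)
        fix k assume k: "k \<in> {1..r * n}"
        have ne: "x - t n k \<noteq> 0" using t[OF n k] x by simp
        have "((\<lambda>x. x / (x - t n k)) has_field_derivative (x / (x - t n k)) * (1 - x / (x - t n k)) / x) (at x)"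
          by (rule derivative_eq_intros refl ne)+ (use ne x in \<open>simp add: divide_simps\<close>)
        then show "((\<lambda>x. poly q (x / (x - t n k))) has_field_derivative
            poly (pderiv q) (x / (x - t n k)) * ((x / (x - t n k)) * (1 - x / (x - t n k)) / x)) (at x)"
          by (rule DERIV_chain2[OF poly_DERIV])
      qed
      then show ?thesis
        unfolding kernel_avg_def by (simp add: sum_divide_distrib sum_distrib_left mult_ac algebra_simps cong: sum.cong)
    qed
    then show ?case using bd[of q] Suc.IH[of "pderiv q * [:0, 1, -1:]"]
      unfolding theta_bounded.simps by blast
  }
qed

section \<open>The algebraic equation for the zeros\<close>

lemma pderiv_monic_roots:
  assumes "\<And>x. poly P x = (\<Prod>k\<in>K. x - t k)" "finite K" "\<And>k. k \<in> K \<Longrightarrow> x \<noteq> t k"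
  shows "poly (pderiv P) x = poly P x * (\<Sum>k\<in>K. 1 / (x - t k :: real))"
proof -
  have "(poly P has_field_derivative poly P x * (\<Sum>k\<in>K. 1 / (x - t k))) (at x)"
    unfolding assms(1)[abs_def] using assms(2,3)
    by (intro has_field_derivative_prod') (auto intro!: derivative_eq_intros)
  then show ?thesis using poly_DERIV DERIV_unique by blast
qed

text \<open>
  With \<open>c = n a + b\<close>, the operator \<open>(\<theta> + c) / n\<close> acts on \<open>(1 - x)\<^sup>\<beta> P g\<close> as multiplication of \<open>g\<close> by
  \<open>h + a\<close>, apart from terms with a factor \<open>1/n\<close>: these come from \<open>b\<close>, from the logarithmic derivative of
  \<open>(1 - x)\<^sup>\<beta>\<close>, and from \<open>\<theta> g\<close>. The last one costs one bounded derivative per step, which is why the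
  statement is made for all \<open>m\<close>.
\<close>

lemma euler_iter_asymptotics:
  fixes P :: "nat \<Rightarrow> real poly" and t :: "nat \<Rightarrow> nat \<Rightarrow> real"
  assumes t: "\<And>n k. n \<ge> 1 \<Longrightarrow> k \<in> {1..r * n} \<Longrightarrow> 0 < t n k"
    and P: "\<And>n x. n \<ge> 1 \<Longrightarrow> poly (P n) x = (\<Prod>k=1..r * n. x - t n k)"
  defines "h \<equiv> kernel_avg r t [:0, 1:]"
  shows "\<exists>g. theta_bounded m g
     \<and> theta_bounded 0 (\<lambda>n x. real n * (g n x - (\<Prod>(a, b)\<leftarrow>L. h n x + a)))
     \<and> (\<forall>n\<ge>1. \<forall>x<0. poly (euler_iter \<beta> (map (\<lambda>(a, b). real n * a + b) L) (P n)) x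
            = (real n * (1 - x)) ^ length L * poly (P n) x * g n x)"
proof (induction L arbitrary: m)
  case Nil
  have "theta_bounded m (\<lambda>n x. 1)" by (rule theta_bounded_const[where B = 1]) simp
  then show ?case by (intro exI[of _ "\<lambda>n x. 1"]) auto
next
  case (Cons ab L)
  obtain a b where ab: "ab = (a, b)" by (cases ab)
  let ?K = "length L" and ?Q = "\<lambda>n x. \<Prod>(a, b)\<leftarrow>L. h n x + a"
  obtain g where g: "theta_bounded (Suc m) g" "theta_bounded 0 (\<lambda>n x. real n * (g n x - ?Q n x))"
    "\<And>n x. n \<ge> 1 \<Longrightarrow> x < 0 \<Longrightarrow> poly (euler_iter \<beta> (map (\<lambda>(a, b). real n * a + b) L) (P n)) x
            = (real n * (1 - x)) ^ ?K * poly (P n) x * g n x"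
    using Cons.IH[of "Suc m"] by blast
  from g(1) obtain g' where g': "theta_bounded m g'"
    "\<And>n x. n \<ge> 1 \<Longrightarrow> x < 0 \<Longrightarrow> (g n has_field_derivative g' n x / x) (at x)" by auto
  \<comment> \<open>The function \<open>x / (x - 1)\<close>, seen as a kernel average over points that all equal 1.\<close>
  define s where "s = kernel_avg 1 (\<lambda>_ _. 1) [:0, 1:]"
  have s: "s n x = x / (x - 1)" if "n \<ge> 1" for n x
    using that by (simp add: s_def kernel_avg_def)
  have bs: "theta_bounded m s" for m unfolding s_def by (rule theta_bounded_kernel_avg) simp
  have bh: "theta_bounded m h" for m unfolding h_def by (rule theta_bounded_kernel_avg) (rule t)
  have bn: "theta_bounded m (\<lambda>n x. 1 / real n)" for m by (rule theta_bounded_const[where B = 1]) simp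
  have bc: "theta_bounded m (\<lambda>n x. c)" for m c by (rule theta_bounded_const[where B = "\<bar>c\<bar>"]) simp
  define G where "G n x = 1 / real n * (g' n x + (\<beta> * s n x + b) * g n x) + (h n x + a) * g n x" for n x
  have 1: "theta_bounded m G"
    unfolding G_def by (intro theta_bounded_add theta_bounded_mult bs bh bn bc g' theta_bounded_SucD[OF g(1)])
  have 2: "theta_bounded 0 (\<lambda>n x. real n * (G n x - (\<Prod>(a, b)\<leftarrow>ab # L. h n x + a)))"
  proof (rule theta_bounded_cong)
    show "theta_bounded 0 (\<lambda>n x. (g' n x + (\<beta> * s n x + b) * g n x) + (h n x + a) * (real n * (g n x - ?Q n x)))"
      by (intro theta_bounded_add theta_bounded_mult bs bh bn bc theta_bounded_0[OF g'(1)] theta_bounded_0[OF g(1)] g(2))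
  qed (simp add: G_def ab field_simps)
  have 3: "poly (euler_iter \<beta> (map (\<lambda>(a, b). real n * a + b) (ab # L)) (P n)) x
            = (real n * (1 - x)) ^ length (ab # L) * poly (P n) x * G n x" if n: "n \<ge> 1" and x: "x < 0" for n x
  proof -
    let ?p = "euler_iter \<beta> (map (\<lambda>(a, b). real n * a + b) L) (P n)"
    have P': "poly (pderiv (P n)) x = poly (P n) x * (real n * h n x / x)"
    proof -
      have "poly (pderiv (P n)) x = poly (P n) x * (\<Sum>k=1..r * n. 1 / (x - t n k))"
        by (rule pderiv_monic_roots) (use P n x t in fastforce)+
      also have "(\<Sum>k=1..r * n. 1 / (x - t n k)) = real n * h n x / x"
        using n x by (simp add: h_def kernel_avg_def sum_divide_distrib sum_distrib_left)
      finally show ?thesis .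
    qed
    have "((\<lambda>x. (real n * (1 - x)) ^ ?K * poly (P n) x * g n x) has_field_derivative
        (real n * (1 - x)) ^ ?K * poly (P n) x * (- real ?K / (1 - x) * g n x + real n * h n x / x * g n x + g' n x / x)) (at x)"
    proof -
      have K: "real ?K * ((real n * (1 - x)) ^ (?K - Suc 0) * (- real n)) = (real n * (1 - x)) ^ ?K * (- real ?K / (1 - x))"
        using n x by (cases ?K) (auto simp: field_simps)
      show ?thesis
        by (rule derivative_eq_intros poly_DERIV g'(2)[OF n x] refl)+
          (use K in \<open>simp add: P' algebra_simps\<close>)
    qed
    then have "(poly ?p has_field_derivative
        (real n * (1 - x)) ^ ?K * poly (P n) x * (- real ?K / (1 - x) * g n x + real n * h n x / x * g n x + g' n x / x)) (at x)"
      by (rule has_field_derivative_transform_within_open[of _ _ _ "{..<0}"]) (use g(3)[OF n] x in auto)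
    then have p': "poly (pderiv ?p) x = (real n * (1 - x)) ^ ?K * poly (P n) x
        * (- real ?K / (1 - x) * g n x + real n * h n x / x * g n x + g' n x / x)"
      using poly_DERIV DERIV_unique by blast
    define M where "M = (real n * (1 - x)) ^ ?K * poly (P n) x"
    have "poly (euler_iter \<beta> (map (\<lambda>(a, b). real n * a + b) (ab # L)) (P n)) x
        = x * (1 - x) * poly (pderiv ?p) x - (\<beta> - real ?K) * (x * poly ?p x) + (real n * a + b) * ((1 - x) * poly ?p x)"
      by (simp add: ab euler_step_def algebra_simps)
    also have "\<dots> = M * (x * (1 - x) * (- real ?K / (1 - x) * g n x + real n * h n x / x * g n x + g' n x / x)
        - (\<beta> - real ?K) * (x * g n x) + (real n * a + b) * ((1 - x) * g n x))"
      unfolding p' g(3)[OF n x] M_def[symmetric] by (simp add: algebra_simps)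
    also have "x * (1 - x) * (- real ?K / (1 - x) * g n x + real n * h n x / x * g n x + g' n x / x)
        - (\<beta> - real ?K) * (x * g n x) + (real n * a + b) * ((1 - x) * g n x)
        = (1 - x) * (g' n x - \<beta> * x / (1 - x) * g n x + b * g n x + real n * ((h n x + a) * g n x))"
      using x by (simp add: divide_simps) (simp add: algebra_simps)
    also have "\<dots> = (real n * (1 - x)) * G n x"
      using n x by (simp add: G_def s divide_simps) (simp add: algebra_simps)
    finally show ?thesis by (simp add: M_def)
  qed
  show ?case using 1 2 3 by blast
qed

text \<open>
  After division by \<open>(s + 1)\<^sup>r\<close> the equation reads \<open>\<phi>(s) = 0\<close> with
  \<open>\<phi>(s) = s (s / (s + 1))\<^sup>r - x (s - r)\<close>, and for \<open>x < 0\<close> this function increases at least with slope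
  \<open>\<bar>x\<bar>\<close>. An approximate root is therefore close to the exact one.
\<close>

lemma characteristic_equation_stable:
  fixes x h H :: real
  assumes x: "x < 0" and h: "0 \<le> h" and H: "0 \<le> H"
    and eqH: "H ^ Suc r = x * ((H - real r) * (H + 1) ^ r)"
  shows "\<bar>h - H\<bar> \<le> \<bar>h ^ Suc r - x * ((h - real r) * (h + 1) ^ r)\<bar> / \<bar>x\<bar>"
proof -
  define \<phi> where "\<phi> s = s * (s / (s + 1)) ^ r - x * (s - real r)" for s :: real
  have \<phi>: "\<phi> s * (s + 1) ^ r = s ^ Suc r - x * ((s - real r) * (s + 1) ^ r)" if "s \<ge> 0" for s
    using that by (simp add: \<phi>_def power_divide field_simps)
  have \<phi>H: "\<phi> H = 0"
    using \<phi>[OF H] eqH H by simp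
  have mono: "\<bar>x\<bar> * (b - a) \<le> \<phi> b - \<phi> a" if "0 \<le> a" "a \<le> b" for a b
  proof -
    have "a / (a + 1) \<le> b / (b + 1)" using that by (simp add: field_simps)
    then have "(a / (a + 1)) ^ r \<le> (b / (b + 1)) ^ r"
      using that by (intro power_mono) auto
    then have "a * (a / (a + 1)) ^ r \<le> b * (b / (b + 1)) ^ r"
      using that by (intro mult_mono) auto
    then show ?thesis using x by (simp add: \<phi>_def algebra_simps)
  qed
  have "\<bar>x\<bar> * \<bar>h - H\<bar> \<le> \<bar>\<phi> h\<bar>"
    using mono[OF h, of H] mono[OF H, of h] \<phi>H by (cases "h \<le> H") (auto simp: abs_if)
  also have "\<dots> \<le> \<bar>\<phi> h\<bar> * (h + 1) ^ r"
    using mult_left_mono[OF one_le_power[of "h + 1" r] abs_ge_zero[of "\<phi> h"]] h by simp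
  also have "\<dots> = \<bar>h ^ Suc r - x * ((h - real r) * (h + 1) ^ r)\<bar>"
    unfolding \<phi>[OF h, symmetric] using h by (simp add: abs_mult)
  finally show ?thesis using x by (simp add: field_simps)
qed

text \<open>
  The two sides of the differential equation consist of operators \<open>\<theta> + n a + b\<close> with
  \<open>(a, b) = (0, 0), (0, \<alpha>\<^sub>j)\<close> and \<open>(a, b) = (-r, -\<beta>), (1, \<alpha>\<^sub>j + 1)\<close>. Hence \<open>h\<close> solves the limit equation
  up to \<open>O(1/n)\<close>, and it converges to the exact root.
\<close>

lemma zero_kernel_limit:
  fixes \<alpha> :: "nat \<Rightarrow> real" and P :: "nat \<Rightarrow> real poly" and t :: "nat \<Rightarrow> nat \<Rightarrow> real"
  assumes b: "\<beta> > -1" and a: "\<And>j. j \<in> {1..r} \<Longrightarrow> \<alpha> j > -1"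
    and ij: "\<And>i j. i \<in> {1..r} \<Longrightarrow> j \<in> {1..r} \<Longrightarrow> i \<noteq> j \<Longrightarrow> \<alpha> i - \<alpha> j \<notin> \<int>"
    and jp: "\<And>n. n \<ge> 1 \<Longrightarrow> jacobi_pineiro r \<alpha> \<beta> (\<lambda>_. n) (P n)"
    and t: "\<And>n k. n \<ge> 1 \<Longrightarrow> k \<in> {1..r * n} \<Longrightarrow> 0 < t n k"
    and P: "\<And>n x. n \<ge> 1 \<Longrightarrow> poly (P n) x = (\<Prod>k=1..r * n. x - t n k)"
    and x: "x < 0" and H: "0 \<le> H" "H ^ Suc r = x * ((H - real r) * (H + 1) ^ r)"
  shows "(\<lambda>n. 1 / real n * (\<Sum>k=1..r * n. x / (x - t n k))) \<longlonglongrightarrow> H"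
proof -
  define h where "h = kernel_avg r t [:0, 1:]"
  define L where "L = (0, 0) # map (\<lambda>j. (0::real, \<alpha> j)) [1..<Suc r]"
  define R where "R = (- real r, - \<beta>) # map (\<lambda>j. (1::real, \<alpha> j + 1)) [1..<Suc r]"
  have hx: "h n x = 1 / real n * (\<Sum>k=1..r * n. x / (x - t n k))" for n
    by (simp add: h_def kernel_avg_def)
  have h0: "h n x \<ge> 0" if "n \<ge> 1" for n
    unfolding hx using kernel_bounds(1)[OF x t[OF that]]
    by (intro mult_nonneg_nonneg sum_nonneg) (auto intro: less_imp_le)
  have Lp: "(\<Prod>(a, b)\<leftarrow>L. h n x + a) = h n x ^ Suc r" for n
    by (simp add: L_def o_def map_replicate_const del: upt_Suc)
  have Rp: "(\<Prod>(a, b)\<leftarrow>R. h n x + a) = (h n x - real r) * (h n x + 1) ^ r" for n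
    by (simp add: R_def o_def map_replicate_const del: upt_Suc)
  have Pn: "poly (P n) x \<noteq> 0" if n: "n \<ge> 1" for n
  proof
    assume "poly (P n) x = 0"
    then obtain k where "k \<in> {1..r * n}" "x = t n k" by (auto simp: P[OF n])
    then show False using t[OF n] x by force
  qed
  obtain g where g: "theta_bounded 0 (\<lambda>n x. real n * (g n x - (\<Prod>(a, b)\<leftarrow>L. h n x + a)))"
    "\<And>n x. n \<ge> 1 \<Longrightarrow> x < 0 \<Longrightarrow> poly (euler_iter \<beta> (map (\<lambda>(a, b). real n * a + b) L) (P n)) x
            = (real n * (1 - x)) ^ length L * poly (P n) x * g n x"
  proof -
    have "\<exists>g. theta_bounded 0 g \<and> theta_bounded 0 (\<lambda>n x. real n * (g n x - (\<Prod>(a, b)\<leftarrow>L. h n x + a)))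
     \<and> (\<forall>n\<ge>1. \<forall>x<0. poly (euler_iter \<beta> (map (\<lambda>(a, b). real n * a + b) L) (P n)) x
            = (real n * (1 - x)) ^ length L * poly (P n) x * g n x)"
      unfolding h_def by (rule euler_iter_asymptotics) (use t P in auto)
    then obtain G where
      "theta_bounded 0 (\<lambda>n x. real n * (G n x - (\<Prod>(a, b)\<leftarrow>L. h n x + a)))"
      "\<forall>n\<ge>1. \<forall>x<0. poly (euler_iter \<beta> (map (\<lambda>(a, b). real n * a + b) L) (P n)) x
            = (real n * (1 - x)) ^ length L * poly (P n) x * G n x"
      by (elim exE conjE)
    then show ?thesis by (intro that[of G]) simp_all
  qed
  obtain g' where g': "theta_bounded 0 (\<lambda>n x. real n * (g' n x - (\<Prod>(a, b)\<leftarrow>R. h n x + a)))"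
    "\<And>n x. n \<ge> 1 \<Longrightarrow> x < 0 \<Longrightarrow> poly (euler_iter \<beta> (map (\<lambda>(a, b). real n * a + b) R) (P n)) x
            = (real n * (1 - x)) ^ length R * poly (P n) x * g' n x"
  proof -
    have "\<exists>g. theta_bounded 0 g \<and> theta_bounded 0 (\<lambda>n x. real n * (g n x - (\<Prod>(a, b)\<leftarrow>R. h n x + a)))
     \<and> (\<forall>n\<ge>1. \<forall>x<0. poly (euler_iter \<beta> (map (\<lambda>(a, b). real n * a + b) R) (P n)) x
            = (real n * (1 - x)) ^ length R * poly (P n) x * g n x)"
      unfolding h_def by (rule euler_iter_asymptotics) (use t P in auto)
    then obtain G where
      "theta_bounded 0 (\<lambda>n x. real n * (G n x - (\<Prod>(a, b)\<leftarrow>R. h n x + a)))"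
      "\<forall>n\<ge>1. \<forall>x<0. poly (euler_iter \<beta> (map (\<lambda>(a, b). real n * a + b) R) (P n)) x
            = (real n * (1 - x)) ^ length R * poly (P n) x * G n x"
      by (elim exE conjE)
    then show ?thesis by (intro that[of G]) simp_all
  qed
  have gg': "g n x = x * g' n x" if n: "n \<ge> 1" for n
  proof -
    have mL: "map (\<lambda>(a, b). real n * a + b) L = 0 # map \<alpha> [1..<Suc r]"
      by (simp add: L_def o_def del: upt_Suc)
    have mR: "map (\<lambda>(a, b). real n * a + b) R = (- \<beta> - real (r * n)) # map (\<lambda>j. \<alpha> j + 1 + real n) [1..<Suc r]"
      by (simp add: R_def o_def algebra_simps del: upt_Suc)
    have len: "length L = Suc r" "length R = Suc r" by (simp_all add: L_def R_def)
    have "poly (euler_iter \<beta> (map (\<lambda>(a, b). real n * a + b) L) (P n)) x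
        = x * poly (euler_iter \<beta> (map (\<lambda>(a, b). real n * a + b) R) (P n)) x"
    proof -
      have "euler_iter \<beta> (0 # map \<alpha> [1..<Suc r]) (P n)
          = [:0, 1:] * euler_iter \<beta> ((- \<beta> - real (r * n)) # map (\<lambda>j. \<alpha> j + 1 + real n) [1..<Suc r]) (P n)"
        by (rule jacobi_pineiro_ode) (use b a ij jp[OF n] in auto)
      then show ?thesis unfolding mL mR by (simp only: poly_mult) simp
    qed
    then have "(real n * (1 - x)) ^ Suc r * poly (P n) x * g n x
        = (real n * (1 - x)) ^ Suc r * poly (P n) x * (x * g' n x)"
      unfolding g(2)[OF n x] g'(2)[OF n x] len by simp
    moreover have "(real n * (1 - x)) ^ Suc r * poly (P n) x \<noteq> 0"
      using Pn[OF n] n x by (intro no_zero_divisors power_not_zero) auto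
    ultimately show ?thesis by (simp only: mult_left_cancel simp_thms)
  qed
  from g(1) obtain B where B0: "\<forall>n\<ge>1. \<forall>x<0. \<bar>real n * (g n x - (\<Prod>(a, b)\<leftarrow>L. h n x + a))\<bar> \<le> B"
    unfolding theta_bounded.simps by (elim exE)
  have B: "\<bar>real n * (g n x - h n x ^ Suc r)\<bar> \<le> B" if "n \<ge> 1" for n
    using B0[rule_format, OF that x] unfolding Lp .
  from g'(1) obtain B' where B0': "\<forall>n\<ge>1. \<forall>x<0. \<bar>real n * (g' n x - (\<Prod>(a, b)\<leftarrow>R. h n x + a))\<bar> \<le> B'"
    unfolding theta_bounded.simps by (elim exE)
  have B': "\<bar>real n * (g' n x - (h n x - real r) * (h n x + 1) ^ r)\<bar> \<le> B'" if "n \<ge> 1" for n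
    using B0'[rule_format, OF that x] unfolding Rp .
  have bd: "\<bar>h n x - H\<bar> \<le> (B + \<bar>x\<bar> * B') / \<bar>x\<bar> * (1 / real n)" if n: "n \<ge> 1" for n
  proof -
    let ?E = "h n x ^ Suc r - x * ((h n x - real r) * (h n x + 1) ^ r)"
    have "real n * ?E = x * (real n * (g' n x - (h n x - real r) * (h n x + 1) ^ r)) - real n * (g n x - h n x ^ Suc r)"
      unfolding gg'[OF n] by (simp add: algebra_simps del: power_Suc)
    then have "\<bar>real n * ?E\<bar> \<le> \<bar>x * (real n * (g' n x - (h n x - real r) * (h n x + 1) ^ r))\<bar> + \<bar>real n * (g n x - h n x ^ Suc r)\<bar>"
      by (rule ssubst) (rule abs_triangle_ineq4)
    also have "\<dots> \<le> \<bar>x\<bar> * B' + B"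
      unfolding abs_mult[of x] by (intro add_mono mult_left_mono B B' n) auto
    finally have "\<bar>?E\<bar> \<le> (B + \<bar>x\<bar> * B') / real n"
      unfolding abs_mult[of "real n"] using n by (simp add: pos_le_divide_eq mult.commute del: power_Suc)
    have "\<bar>h n x - H\<bar> \<le> \<bar>?E\<bar> / \<bar>x\<bar>"
      by (rule characteristic_equation_stable[OF x h0[OF n] H])
    also have "\<dots> \<le> (B + \<bar>x\<bar> * B') / real n / \<bar>x\<bar>"
      using \<open>\<bar>?E\<bar> \<le> (B + \<bar>x\<bar> * B') / real n\<close> by (intro divide_right_mono) auto
    also have "\<dots> = (B + \<bar>x\<bar> * B') / \<bar>x\<bar> * (1 / real n)" by simp
    finally show ?thesis .
  qed
  have lim: "(\<lambda>n. (B + \<bar>x\<bar> * B') / \<bar>x\<bar> * (1 / real n)) \<longlonglongrightarrow> 0"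
    by (rule tendsto_mult_right_zero[OF lim_1_over_n])
  have "(\<lambda>n. h n x - H) \<longlonglongrightarrow> 0"
  proof (rule Lim_null_comparison[OF _ lim])
    show "\<forall>\<^sub>F n in sequentially. norm (h n x - H) \<le> (B + \<bar>x\<bar> * B') / \<bar>x\<bar> * (1 / real n)"
      using eventually_ge_at_top[of 1] by eventually_elim (simp only: real_norm_def bd)
  qed
  then show ?thesis unfolding hx by (rule LIM_zero_cancel)
qed

section \<open>The change of variables\<close>

lemma sin_angle_pos:
  fixes \<phi> :: real
  assumes "r \<ge> 1" "0 < \<phi>" "\<phi> < pi / real (r + 1)"
  shows "0 < sin \<phi>" "0 < sin (real r * \<phi>)" "0 < sin (real (r + 1) * \<phi>)" "sin \<phi> \<le> sin (real r * \<phi>)"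
proof -
  have 1: "real (r + 1) * \<phi> < pi" using assms by (simp add: field_simps)
  have 2: "\<phi> \<le> real r * \<phi>" "0 < real r * \<phi>" using assms by simp_all
  have 3: "real r * \<phi> + \<phi> < pi" using 1 by (simp add: algebra_simps)
  have 4: "\<phi> < pi" "real r * \<phi> < pi" using 2 3 assms(2) by linarith+
  show "0 < sin \<phi>" using assms 4 by (intro sin_gt_zero) auto
  show "0 < sin (real r * \<phi>)" using 2 4 by (intro sin_gt_zero) auto
  show "0 < sin (real (r + 1) * \<phi>)" using assms 1 by (intro sin_gt_zero) auto
  show "sin \<phi> \<le> sin (real r * \<phi>)"
  proof -
    have "sin (real r * \<phi>) - sin \<phi> = 2 * sin ((real r * \<phi> - \<phi>) / 2) * cos ((real r * \<phi> + \<phi>) / 2)"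
      by (rule sin_diff_sin)
    moreover have "0 \<le> (real r * \<phi> - \<phi>) / 2" "(real r * \<phi> - \<phi>) / 2 \<le> pi"
      "- (pi / 2) \<le> (real r * \<phi> + \<phi>) / 2" "(real r * \<phi> + \<phi>) / 2 \<le> pi / 2"
      using assms(2) 2 3 4 pi_gt_zero by (simp_all, linarith?)
    then have "sin ((real r * \<phi> - \<phi>) / 2) \<ge> 0" "cos ((real r * \<phi> + \<phi>) / 2) \<ge> 0"
      by (intro sin_ge_zero cos_ge_zero; simp)+
    then have "0 \<le> 2 * sin ((real r * \<phi> - \<phi>) / 2) * cos ((real r * \<phi> + \<phi>) / 2)" by simp
    ultimately show ?thesis by linarith
  qed
qed

definition xhat_denom :: "nat \<Rightarrow> real \<Rightarrow> real" where
  "xhat_denom r \<phi> = real (r + 1) ^ 2 * sin (real r * \<phi>) ^ 2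
                - 2 * real r * real (r + 1) * sin (real (r + 1) * \<phi>) * sin (real r * \<phi>) * cos \<phi>
                + real r ^ 2 * sin (real (r + 1) * \<phi>) ^ 2"

text \<open>
  The denominator is \<open>\<bar>(r + 1) sin r\<phi> - r sin (r + 1)\<phi> exp(i \<phi>)\<bar>\<^sup>2\<close>.
\<close>

lemma xhat_denom_pos:
  assumes "r \<ge> 1" "0 < \<phi>" "\<phi> < pi / real (r + 1)"
  shows "xhat_denom r \<phi> > 0"
proof -
  note p = sin_angle_pos[OF assms]
  have "xhat_denom r \<phi> = (real (r + 1) * sin (real r * \<phi>) - real r * sin (real (r + 1) * \<phi>) * cos \<phi>)\<^sup>2
      + (real r * sin (real (r + 1) * \<phi>) * sin \<phi>)\<^sup>2"
    unfolding power_mult_distrib sin_squared_eq[of \<phi>] xhat_denom_def power2_diff by (simp add: algebra_simps power2_eq_square)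
  moreover have "real r * sin (real (r + 1) * \<phi>) * sin \<phi> > 0" using p assms(1) by simp
  ultimately show ?thesis by (simp only:) (intro add_nonneg_pos zero_less_power zero_le_power2)
qed

lemma xhat_pos: "r \<ge> 1 \<Longrightarrow> 0 < \<phi> \<Longrightarrow> \<phi> < pi / real (r + 1) \<Longrightarrow> xhat r \<phi> > 0"
  using sin_angle_pos[of r \<phi>] by (simp add: xhat_def del: of_nat_add)

text \<open>
  Logarithmic differentiation gives
  \<open>(r + 1)\<^sup>2 cot (r + 1)\<phi> - cot \<phi> - r\<^sup>2 cot r\<phi>\<close>; the addition theorems turn its numerator into the
  negative of \<open>xhat_denom\<close>.
\<close>

lemma xhat_has_derivative:
  assumes "r \<ge> 1" "0 < \<phi>" "\<phi> < pi / real (r + 1)"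
  shows "(xhat r has_field_derivative
      - (xhat r \<phi> * xhat_denom r \<phi> / (sin \<phi> * sin (real r * \<phi>) * sin (real (r + 1) * \<phi>)))) (at \<phi>)"
proof -
  note p = sin_angle_pos[OF assms]
  define S R s C D c where d: "S = sin (real (r + 1) * \<phi>)" "R = sin (real r * \<phi>)" "s = sin \<phi>"
    "C = cos (real (r + 1) * \<phi>)" "D = cos (real r * \<phi>)" "c = cos \<phi>"
  have pos: "S > 0" "R > 0" "s > 0" using p by (simp_all add: d)
  have e: "real (r + 1) * \<phi> = real r * \<phi> + \<phi>" by (simp add: algebra_simps)
  have sc: "s * s = 1 - c * c" unfolding d using sin_squared_eq[of \<phi>] by (simp add: power2_eq_square)
  have S: "S = R * c + D * s" unfolding d e by (rule sin_add)
  have C: "C = D * c - R * s" unfolding d e by (rule cos_add)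
  have Cs: "C * s = S * c - R"
  proof -
    have "C * s = D * c * s - R * (s * s)" unfolding C by (simp add: algebra_simps)
    also have "\<dots> = S * c - R" unfolding sc S by (simp add: algebra_simps)
    finally show ?thesis .
  qed
  have Ds: "D * s = S - R * c" by (simp add: S)
  have x: "xhat r \<phi> = S ^ (r + 1) / (s * R ^ r)" by (simp add: xhat_def d)
  have dS: "((\<lambda>\<phi>. sin (real (r + 1) * \<phi>)) has_field_derivative C * real (r + 1)) (at \<phi>)"
    and dR: "((\<lambda>\<phi>. sin (real r * \<phi>)) has_field_derivative D * real r) (at \<phi>)"
    and ds: "(sin has_field_derivative c) (at \<phi>)"
    unfolding d by (auto intro!: derivative_eq_intros)
  have dN: "((\<lambda>\<phi>. sin (real (r + 1) * \<phi>) ^ (r + 1)) has_field_derivative S ^ (r + 1) * (real (r + 1) ^ 2 * C / S)) (at \<phi>)"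
    by (rule DERIV_cong[OF DERIV_power[OF dS]]) (unfold d(1)[symmetric], use pos in \<open>simp add: power2_eq_square field_simps\<close>)
  have dM: "((\<lambda>\<phi>. sin \<phi> * sin (real r * \<phi>) ^ r) has_field_derivative s * R ^ r * (c / s + real r ^ 2 * D / R)) (at \<phi>)"
  proof (rule DERIV_cong[OF DERIV_mult[OF ds DERIV_power[OF dR]]])
    obtain q where q: "r = Suc q" using assms(1) by (cases r) auto
    show "c * sin (real r * \<phi>) ^ r + of_nat r * (D * real r * sin (real r * \<phi>) ^ (r - Suc 0)) * sin \<phi>
        = s * R ^ r * (c / s + real r ^ 2 * D / R)"
      unfolding d(2,3)[symmetric] using pos by (simp add: q power2_eq_square field_simps del: of_nat_Suc)
  qed
  have M: "sin \<phi> * sin (real r * \<phi>) ^ r \<noteq> 0" using p by simp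
  have "(xhat r has_field_derivative xhat r \<phi> * ((real (r + 1) ^ 2 * C / S) - (c / s + real r ^ 2 * D / R))) (at \<phi>)"
    unfolding xhat_def[abs_def]
  proof (rule DERIV_cong[OF DERIV_divide[OF dN dM M]])
    have "(N * a * M - N * (M * b)) / (M * M) = N / M * (a - b)" if "M \<noteq> 0" for N M a b :: real
      using that by (simp add: field_simps)
    from this[OF M] show "(S ^ (r + 1) * (real (r + 1) ^ 2 * C / S) * (sin \<phi> * sin (real r * \<phi>) ^ r)
          - sin (real (r + 1) * \<phi>) ^ (r + 1) * (s * R ^ r * (c / s + real r ^ 2 * D / R)))
          / (sin \<phi> * sin (real r * \<phi>) ^ r * (sin \<phi> * sin (real r * \<phi>) ^ r))
        = sin (real (r + 1) * \<phi>) ^ (r + 1) / (sin \<phi> * sin (real r * \<phi>) ^ r)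
          * ((real (r + 1) ^ 2 * C / S) - (c / s + real r ^ 2 * D / R))"
      unfolding d(1,2,3) .
  qed
  also have "xhat r \<phi> * ((real (r + 1) ^ 2 * C / S) - (c / s + real r ^ 2 * D / R))
     = xhat r \<phi> * (real (r + 1) ^ 2 * (C * s) * R - c * R * S - real r ^ 2 * (D * s) * S) / (s * R * S)"
    using pos by (simp add: field_simps del: of_nat_add)
  also have "real (r + 1) ^ 2 * (C * s) * R - c * R * S - real r ^ 2 * (D * s) * S = - xhat_denom r \<phi>"
    unfolding Cs Ds xhat_denom_def d[symmetric] by (simp add: algebra_simps power2_eq_square)
  finally show ?thesis by (simp add: d mult_ac)
qed

lemma deriv_xhat_neg:
  assumes "r \<ge> 1" "0 < \<phi>" "\<phi> < pi / real (r + 1)"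
  shows "deriv (xhat r) \<phi> = - (xhat r \<phi> * xhat_denom r \<phi> / (sin \<phi> * sin (real r * \<phi>) * sin (real (r + 1) * \<phi>)))"
    and "deriv (xhat r) \<phi> < 0" and "(xhat r has_field_derivative deriv (xhat r) \<phi>) (at \<phi>)"
proof -
  show 1: "deriv (xhat r) \<phi> = - (xhat r \<phi> * xhat_denom r \<phi> / (sin \<phi> * sin (real r * \<phi>) * sin (real (r + 1) * \<phi>)))"
    by (rule DERIV_imp_deriv[OF xhat_has_derivative[OF assms]])
  show "(xhat r has_field_derivative deriv (xhat r) \<phi>) (at \<phi>)"
    unfolding 1 by (rule xhat_has_derivative[OF assms])
  show "deriv (xhat r) \<phi> < 0"
    unfolding 1 using xhat_pos[OF assms] xhat_denom_pos[OF assms] sin_angle_pos[OF assms]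
    by (simp del: of_nat_add)
qed

lemma xhat_strict_antimono:
  assumes r: "r \<ge> 1" and *: "0 < a" "a < b" "b < pi / real (r + 1)"
  shows "xhat r b < xhat r a"
proof (rule DERIV_neg_imp_decreasing[OF *(2)])
  fix x assume "a \<le> x" "x \<le> b"
  then show "\<exists>y. DERIV (xhat r) x :> y \<and> y < 0"
    using deriv_xhat_neg[OF r, of x] * by auto
qed

lemma inj_on_xhat: "r \<ge> 1 \<Longrightarrow> inj_on (xhat r) {0<..<pi / real (r + 1)}"
  by (rule linorder_inj_onI') (use xhat_strict_antimono[of r] in fastforce)

lemma xhat_tendsto_c_const:
  assumes "r \<ge> 1" shows "(xhat r \<longlongrightarrow> c_const r) (at_right 0)"
proof -
  define R where "R = real r"
  have R: "R > 0" using assms by (simp add: R_def)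
  have f1: "((\<lambda>\<phi>. sin ((R + 1) * \<phi>) / \<phi>) \<longlongrightarrow> R + 1) (at_right 0)"
    and f2: "((\<lambda>\<phi>. sin (R * \<phi>) / \<phi>) \<longlongrightarrow> R) (at_right 0)"
    and f3: "((\<lambda>\<phi>::real. sin \<phi> / \<phi>) \<longlongrightarrow> 1) (at_right 0)"
    using R by real_asymp+
  have "((\<lambda>\<phi>. (sin ((R + 1) * \<phi>) / \<phi>) ^ (r + 1) / ((sin \<phi> / \<phi>) * (sin (R * \<phi>) / \<phi>) ^ r)) \<longlongrightarrow> (R + 1) ^ (r + 1) / (1 * R ^ r)) (at_right 0)"
    by (intro tendsto_intros f1 f2 f3) (use R in auto)
  moreover have "eventually (\<lambda>\<phi>. (sin ((R + 1) * \<phi>) / \<phi>) ^ (r + 1) / ((sin \<phi> / \<phi>) * (sin (R * \<phi>) / \<phi>) ^ r) = xhat r \<phi>) (at_right 0)"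
    unfolding eventually_at_right_field
    by (intro exI[of _ 1]) (auto simp: xhat_def R_def power_divide field_simps)
  ultimately show ?thesis
    by (subst (asm) tendsto_cong) (auto simp: c_const_def R_def add.commute)
qed

lemma xhat_end: "xhat r (pi / real (r + 1)) = 0"
  by (simp add: xhat_def del: of_nat_add)

lemma xhat_tendsto_end:
  assumes "r \<ge> 1" shows "(xhat r \<longlongrightarrow> 0) (at_left (pi / real (r + 1)))"
proof -
  have "0 < pi / real (r + 1)" "real r * (pi / real (r + 1)) < pi" "pi / real (r + 1) < pi" "0 < real r * (pi / real (r + 1))"
    using assms by (simp_all add: field_simps)
  then have "sin (pi / real (r + 1)) > 0" "sin (real r * (pi / real (r + 1))) > 0"
    by (intro sin_gt_zero; simp)+
  then have "isCont (xhat r) (pi / real (r + 1))"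
    unfolding xhat_def[abs_def] by (intro continuous_intros) auto
  then have "(xhat r \<longlongrightarrow> xhat r (pi / real (r + 1))) (at (pi / real (r + 1)))" by (simp add: isCont_def)
  then show ?thesis unfolding xhat_end by (rule filterlim_mono) (simp_all add: at_within_le_nhds at_le)
qed

lemma xhat_image:
  assumes r: "r \<ge> 1"
  shows "xhat r ` {0<..<pi / real (r + 1)} = {0<..<c_const r}"
proof
  let ?a = "pi / real (r + 1)"
  have a: "?a > 0" by simp
  have cont: "continuous_on {0<..<?a} (xhat r)"
    by (intro continuous_at_imp_continuous_on) (use deriv_xhat_neg(3)[OF r, THEN DERIV_isCont] in auto)
  show "xhat r ` {0<..<?a} \<subseteq> {0<..<c_const r}"
  proof clarify
    fix \<phi> assume "\<phi> \<in> {0<..<?a}"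
    then have p: "0 < \<phi>" "\<phi> < ?a" by auto
    have "xhat r (\<phi> / 2) \<le> c_const r"
    proof (rule tendsto_lowerbound[OF xhat_tendsto_c_const[OF r]])
      show "\<forall>\<^sub>F x in at_right 0. xhat r (\<phi> / 2) \<le> xhat r x"
        unfolding eventually_at_right_field
      proof (intro exI[of _ "\<phi> / 2"] conjI allI impI)
        fix y assume "0 < y" "y < \<phi> / 2"
        moreover have "\<phi> / 2 < ?a" using p by linarith
        ultimately show "xhat r (\<phi> / 2) \<le> xhat r y"
          by (intro less_imp_le xhat_strict_antimono[OF r])
      qed (use p in simp)
    qed simp
    moreover have "xhat r \<phi> < xhat r (\<phi> / 2)" using p by (intro xhat_strict_antimono r) auto
    ultimately show "xhat r \<phi> \<in> {0<..<c_const r}" using xhat_pos[OF r p] by auto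
  qed
  show "{0<..<c_const r} \<subseteq> xhat r ` {0<..<?a}"
  proof
    fix y assume y: "y \<in> {0<..<c_const r}"
    have "eventually (\<lambda>x. xhat r x > y) (at_right 0)"
      using order_tendstoD(1)[OF xhat_tendsto_c_const[OF r]] y by auto
    then obtain b where b: "b > 0" "\<And>x. 0 < x \<Longrightarrow> x < b \<Longrightarrow> xhat r x > y"
      unfolding eventually_at_right_field by auto
    have "eventually (\<lambda>x. xhat r x < y) (at_left ?a)"
      using order_tendstoD(2)[OF xhat_tendsto_end[OF r]] y by auto
    then obtain d where d: "d < ?a" "\<And>x. d < x \<Longrightarrow> x < ?a \<Longrightarrow> xhat r x < y"
      unfolding eventually_at_left_field by auto
    have "\<exists>p q. 0 < p \<and> p < b \<and> p < A \<and> p \<le> q \<and> d < q \<and> q < A" if "d < A" "0 < A" for A :: real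
      using b(1) that by (intro exI[of _ "min b A / 2"] exI[of _ "max (min b A / 2) ((max d 0 + A) / 2)"])
        (auto simp: min_def max_def field_simps)
    from this[OF d(1) a] obtain p q where pq: "0 < p" "p < b" "p < ?a" "p \<le> q" "d < q" "q < ?a"
      by (elim exE conjE)
    have "\<exists>x\<ge>p. x \<le> q \<and> xhat r x = y"
    proof (rule IVT2')
      show "xhat r q \<le> y" by (rule less_imp_le[OF d(2)[OF pq(5,6)]])
      show "y \<le> xhat r p" by (rule less_imp_le[OF b(2)[OF pq(1,2)]])
      have "{p..q} \<subseteq> {0<..<?a}" using pq by (simp only: greaterThanLessThan_subseteq_greaterThanLessThan subset_iff atLeastAtMost_iff greaterThanLessThan_iff) linarith
      then show "continuous_on {p..q} (xhat r)" by (rule continuous_on_subset[OF cont])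
    qed (rule pq)
    then obtain x where x: "p \<le> x" "x \<le> q" "xhat r x = y" by (elim exE conjE)
    have "x \<in> {0<..<?a}"
      unfolding greaterThanLessThan_iff using order_less_le_trans[OF pq(1) x(1)] order_le_less_trans[OF x(2) pq(6)] by (rule conjI)
    then show "y \<in> xhat r ` {0<..<?a}" using x(3) by (rule rev_image_eqI[OF _ sym])
  qed
qed

lemma w_dens_xhat:
  assumes "r \<ge> 1" "\<phi> \<in> {0<..<pi / real (r + 1)}"
  shows "w_dens r (xhat r \<phi>) = real (r + 1) / pi * (1 / \<bar>deriv (xhat r) \<phi>\<bar>)"
  unfolding w_dens_def the_inv_into_f_f[OF inj_on_xhat[OF assms(1)] assms(2)] by simp

lemma w_dens_xhat_explicit:
  assumes "r \<ge> 1" "\<phi> \<in> {0<..<pi / real (r + 1)}"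
  shows "w_dens r (xhat r \<phi>) = real (r + 1) / (pi * xhat r \<phi>) *
              (sin \<phi> * sin (real r * \<phi>) * sin (real (r + 1) * \<phi>) / xhat_denom r \<phi>)"
proof -
  have p: "0 < \<phi>" "\<phi> < pi / real (r + 1)" using assms by auto
  show ?thesis
    unfolding w_dens_xhat[OF assms] deriv_xhat_neg(1)[OF assms(1) p]
    using xhat_pos[OF assms(1) p] xhat_denom_pos[OF assms(1) p] sin_angle_pos[OF assms(1) p]
    by (simp add: abs_mult del: of_nat_add)
qed

lemma continuous_on_xhat: "r \<ge> 1 \<Longrightarrow> continuous_on {0<..<pi / real (r + 1)} (xhat r)"
  by (intro continuous_at_imp_continuous_on) (use deriv_xhat_neg(3)[THEN DERIV_isCont] in auto)

text \<open>
  Continuity of the inverse of \<open>xhat\<close> is what makes the density Borel measurable.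
\<close>

lemma continuous_on_w_dens:
  assumes r: "r \<ge> 1"
  shows "continuous_on {0<..<c_const r} (w_dens r)"
proof -
  let ?S = "{0<..<pi / real (r + 1)}"
  let ?d = "\<lambda>\<phi>. - (xhat r \<phi> * xhat_denom r \<phi> / (sin \<phi> * sin (real r * \<phi>) * sin (real (r + 1) * \<phi>)))"
  have "path_connected ?S" by (rule convex_imp_path_connected) (rule convex_real_interval)
  then obtain g where g: "homeomorphism ?S (xhat r ` ?S) (xhat r) g"
    using injective_into_1d_eq_homeomorphism[OF continuous_on_xhat[OF r]] inj_on_xhat[OF r] by blast
  have nz: "sin \<phi> * sin (real r * \<phi>) * sin (real (r + 1) * \<phi>) \<noteq> 0" "?d \<phi> \<noteq> 0" if "\<phi> \<in> ?S" for \<phi>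
    using sin_angle_pos[OF r, of \<phi>] xhat_pos[OF r, of \<phi>] xhat_denom_pos[OF r, of \<phi>] that
    by (simp_all del: of_nat_add)
  have d: "continuous_on ?S ?d"
    unfolding xhat_denom_def
    by (intro continuous_intros continuous_on_xhat[OF r]) (use nz in blast)
  have gS: "g ` {0<..<c_const r} = ?S" and gc: "continuous_on {0<..<c_const r} g"
    using g unfolding homeomorphism_def xhat_image[OF r] by auto
  define D where "D y = ?d (g y)" for y
  have "continuous_on {0<..<c_const r} D"
    using continuous_on_compose[OF gc] d gS unfolding D_def[abs_def] by (simp add: o_def)
  moreover have "D y \<noteq> 0" if "y \<in> {0<..<c_const r}" for y
    unfolding D_def by (rule nz(2)) (use gS that in blast)
  ultimately have "continuous_on {0<..<c_const r} (\<lambda>y. real (r + 1) / pi * (1 / \<bar>D y\<bar>))"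
    by (intro continuous_intros) auto
  moreover have "w_dens r y = real (r + 1) / pi * (1 / \<bar>D y\<bar>)" if y: "y \<in> {0<..<c_const r}" for y
  proof -
    have 1: "g y \<in> ?S" using gS y by blast
    have 2: "xhat r (g y) = y" using g y unfolding homeomorphism_def xhat_image[OF r] by blast
    show ?thesis using w_dens_xhat[OF r 1] deriv_xhat_neg(1)[OF r, of "g y"] 1 unfolding D_def 2 by (simp only: greaterThanLessThan_iff)
  qed
  ultimately show ?thesis by (subst continuous_on_cong[OF refl]) auto
qed

lemma c_const_pos: "r \<ge> 1 \<Longrightarrow> c_const r > 0"
  by (simp add: c_const_def)

text \<open>
  The density is defined to be inversely proportional to the Jacobian of
  \<open>\<phi> \<mapsto> xhat r \<phi> / c_const r\<close>, so that the substitution leaves a constant.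
\<close>

lemma v_dens_integral:
  assumes r: "r \<ge> 1" and f: "continuous_on {0..1} f"
  shows "(LBINT t:{0..1}. f t * v_dens r t)
     = real (r + 1) / pi * integral {0<..<pi / real (r + 1)} (\<lambda>\<phi>. f (xhat r \<phi> / c_const r))"
    and "(\<lambda>\<phi>. f (xhat r \<phi> / c_const r)) integrable_on {0<..<pi / real (r + 1)}"
proof -
  let ?a = "pi / real (r + 1)"
  let ?S = "{0<..<?a}"
  let ?g = "\<lambda>\<phi>. xhat r \<phi> / c_const r" and ?g' = "\<lambda>\<phi>. deriv (xhat r) \<phi> / c_const r"
  let ?h = "\<lambda>t. f t * v_dens r t"
  note c = c_const_pos[OF r]
  have gS: "?g ` ?S = {0<..<1}"
  proof -
    have "?g ` ?S = (\<lambda>y. y / c_const r) ` {0<..<c_const r}"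
      unfolding xhat_image[OF r, symmetric] image_image ..
    also have "\<dots> = {0<..<1}"
    proof (intro equalityI subsetI)
      fix t :: real assume "t \<in> {0<..<1}"
      then show "t \<in> (\<lambda>y. y / c_const r) ` {0<..<c_const r}"
        using c by (intro image_eqI[of _ _ "t * c_const r"]) auto
    qed (use c in auto)
    finally show ?thesis .
  qed
  have injg: "inj_on ?g ?S"
  proof (rule inj_onI)
    fix x y assume xy: "x \<in> ?S" "y \<in> ?S" and "?g x = ?g y"
    then have "xhat r x = xhat r y" using c by simp
    then show "x = y" by (rule inj_onD[OF inj_on_xhat[OF r] _ xy])
  qed
  have cg: "continuous_on ?S ?g"
    by (intro continuous_on_divide continuous_on_xhat[OF r] continuous_on_const) (use c in simp)
  have fg: "continuous_on ?S (\<lambda>\<phi>. f (?g \<phi>))"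
    by (rule continuous_on_compose2[OF f cg]) (unfold gS, auto)
  have "bounded (f ` {0..1})" by (intro compact_imp_bounded compact_continuous_image f compact_Icc)
  then obtain B where B: "\<And>t. t \<in> {0..1} \<Longrightarrow> norm (f t) \<le> B"
    unfolding bounded_iff by blast
  have S: "?S \<in> sets lebesgue" by simp
  have ai: "(\<lambda>\<phi>. f (?g \<phi>)) absolutely_integrable_on ?S"
  proof (rule measurable_bounded_by_integrable_imp_absolutely_integrable[where g = "\<lambda>_. B"])
    show "(\<lambda>\<phi>. f (?g \<phi>)) \<in> borel_measurable (lebesgue_on ?S)"
      by (rule continuous_imp_measurable_on_sets_lebesgue[OF fg S])
    show "(\<lambda>_. B) integrable_on ?S"
      by (intro integrable_on_const) simp
    show "norm (f (?g \<phi>)) \<le> B" if "\<phi> \<in> ?S" for \<phi>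
    proof -
      have "?g \<phi> \<in> {0<..<1}" using gS that by blast
      then show ?thesis by (intro B) auto
    qed
  qed simp
  then show "(\<lambda>\<phi>. f (?g \<phi>)) integrable_on ?S"
    using absolutely_integrable_on_def by blast
  have eq: "\<bar>?g' \<phi>\<bar> * ?h (?g \<phi>) = real (r + 1) / pi * f (?g \<phi>)" if p: "\<phi> \<in> ?S" for \<phi>
  proof -
    have "deriv (xhat r) \<phi> < 0" using deriv_xhat_neg(2)[OF r] p by auto
    then show ?thesis
      using c w_dens_xhat[OF r p] by (simp add: v_dens_def abs_mult del: of_nat_add)
  qed
  have both: "(\<lambda>\<phi>. \<bar>?g' \<phi>\<bar> * ?h (?g \<phi>)) absolutely_integrable_on ?S \<and>
      integral ?S (\<lambda>\<phi>. \<bar>?g' \<phi>\<bar> * ?h (?g \<phi>)) = real (r + 1) / pi * integral ?S (\<lambda>\<phi>. f (?g \<phi>))"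
  proof
    have k: "(\<lambda>\<phi>. real (r + 1) / pi * f (?g \<phi>)) absolutely_integrable_on ?S"
      by (rule set_integrable_mult_right[OF ai])
    show "(\<lambda>\<phi>. \<bar>?g' \<phi>\<bar> * ?h (?g \<phi>)) absolutely_integrable_on ?S"
      by (rule absolutely_integrable_spike[OF k negligible_empty]) (simp only: Diff_empty eq)
    show "integral ?S (\<lambda>\<phi>. \<bar>?g' \<phi>\<bar> * ?h (?g \<phi>)) = real (r + 1) / pi * integral ?S (\<lambda>\<phi>. f (?g \<phi>))"
      by (subst integral_mult_right[symmetric]) (intro integral_cong eq)
  qed
  have der: "(?g has_field_derivative ?g' \<phi>) (at \<phi> within ?S)" if "\<phi> \<in> ?S" for \<phi>
    using that unfolding greaterThanLessThan_iff
    by (intro DERIV_cdivide has_field_derivative_at_within[OF deriv_xhat_neg(3)[OF r]]) simp_all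
  have "?h absolutely_integrable_on (?g ` ?S) \<and> integral (?g ` ?S) ?h = real (r + 1) / pi * integral ?S (\<lambda>\<phi>. f (?g \<phi>))"
    by (rule iffD1, rule has_absolute_integral_change_of_variables_1', rule S, erule der, rule injg, rule both)
  then have h: "?h absolutely_integrable_on {0<..<1}"
      "integral {0<..<1} ?h = real (r + 1) / pi * integral ?S (\<lambda>\<phi>. f (?g \<phi>))"
    unfolding gS by (rule conjunct1, rule conjunct2)
  have "continuous_on {0<..<1} ?h"
    unfolding v_dens_def
    by (intro continuous_intros continuous_on_compose2[OF continuous_on_w_dens[OF r]] continuous_on_subset[OF f])
      (use c in auto)
  then have "(\<lambda>x. indicator {0<..<1} x *\<^sub>R ?h x) \<in> borel_measurable borel"
    by (intro borel_measurable_continuous_on_indicator) auto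
  with h(1) have "set_integrable lborel {0<..<1} ?h"
    unfolding set_integrable_def by (subst (asm) integrable_completion) auto
  then have "(LBINT t:{0<..<1}. ?h t) = integral {0<..<1} ?h"
    by (rule set_borel_integral_eq_integral(2))
  moreover have "(LBINT t:{0..1}. ?h t) = (LBINT t:{0<..<1}. ?h t)"
    using interval_integral_Icc[of 0 1 ?h] interval_integral_Ioo[of 0 1 ?h] by (simp add: zero_ereal_def one_ereal_def)
  ultimately show "(LBINT t:{0..1}. ?h t) = real (r + 1) / pi * integral ?S (\<lambda>\<phi>. f (?g \<phi>))"
    using h(2) by simp
qed

section \<open>The Stieltjes transform of the limit density\<close>

text \<open>
  The curve \<open>v(\<phi>)\<close>, one half of a loop around 0: it runs in the upper half plane from \<open>1/r\<close> to
  \<open>-1\<close>. The value at 0 is the limit there.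
\<close>

definition loop :: "nat \<Rightarrow> real \<Rightarrow> complex" where
  "loop r \<phi> = (if \<phi> = 0 then of_real (1 / real r)
     else of_real (sin \<phi> / sin (real r * \<phi>)) * cis (real (r + 1) * \<phi>))"

lemma loop_plus_1:
  assumes "r \<ge> 1" "0 < \<phi>" "\<phi> < pi / real (r + 1)"
  shows "1 + loop r \<phi> = of_real (sin (real (r + 1) * \<phi>) / sin (real r * \<phi>)) * cis \<phi>"
proof -
  note p = sin_angle_pos[OF assms]
  have "sin (real r * \<phi>) = sin (real (r + 1) * \<phi>) * cos \<phi> - cos (real (r + 1) * \<phi>) * sin \<phi>"
    unfolding sin_diff[symmetric] by (simp add: algebra_simps)
  then show ?thesis
    using p assms(2) by (simp add: loop_def complex_eq_iff divide_simps del: of_nat_add)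
qed

text \<open>
  The origin of the function \<open>xhat\<close>: on the curve, \<open>1 + v\<close> has argument \<open>\<phi>\<close> and \<open>v\<close> has argument
  \<open>(r + 1) \<phi>\<close>, so that \<open>(1 + v)\<^sup>r\<^sup>+\<^sup>1 / v\<close> is real.
\<close>

lemma loop_power_xhat:
  assumes "r \<ge> 1" "0 < \<phi>" "\<phi> < pi / real (r + 1)"
  shows "(1 + loop r \<phi>) ^ (r + 1) = of_real (xhat r \<phi>) * loop r \<phi>"
proof -
  note p = sin_angle_pos[OF assms]
  have "(1 + loop r \<phi>) ^ (r + 1) = of_real ((sin (real (r + 1) * \<phi>) / sin (real r * \<phi>)) ^ (r + 1)) * cis (real (r + 1) * \<phi>)"
    unfolding loop_plus_1[OF assms] power_mult_distrib Complex.DeMoivre by simp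
  also have "(sin (real (r + 1) * \<phi>) / sin (real r * \<phi>)) ^ (r + 1) = xhat r \<phi> * (sin \<phi> / sin (real r * \<phi>))"
    using p by (simp add: xhat_def power_divide del: of_nat_add)
  finally show ?thesis using assms(2) by (simp add: loop_def)
qed

lemma Im_loop_pos:
  assumes "r \<ge> 1" "0 < \<phi>" "\<phi> < pi / real (r + 1)"
  shows "Im (loop r \<phi>) > 0"
  using sin_angle_pos[OF assms] assms(2) by (simp add: loop_def del: of_nat_add)

lemma loop_end:
  assumes "r \<ge> 1"
  shows "loop r (pi / real (r + 1)) = -1"
proof -
  let ?a = "pi / real (r + 1)"
  have "0 < ?a" "?a < pi" using assms by (simp_all add: field_simps)
  then have s: "sin ?a > 0" by (rule sin_gt_zero)
  have "real r * ?a = pi - ?a" by (simp add: field_simps)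
  then have "sin (real r * ?a) = sin ?a" by simp
  moreover have "real (r + 1) * ?a = pi" by simp
  ultimately show ?thesis using s unfolding loop_def by (simp del: of_nat_add)
qed

lemma norm_loop_le:
  assumes "r \<ge> 1" "0 \<le> \<phi>" "\<phi> \<le> pi / real (r + 1)"
  shows "norm (loop r \<phi>) \<le> 1"
proof -
  consider "\<phi> = 0" | "\<phi> = pi / real (r + 1)" | "0 < \<phi>" "\<phi> < pi / real (r + 1)"
    using assms by linarith
  then show ?thesis
  proof cases
    case 1 then show ?thesis using assms(1) by (simp add: loop_def norm_divide)
  next
    case 2 then show ?thesis using loop_end[OF assms(1)] by simp
  next
    case 3
    then show ?thesis using sin_angle_pos[OF assms(1) 3] unfolding loop_def norm_mult by (simp add: norm_mult norm_divide)
  qed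
qed

lemma continuous_on_loop:
  assumes "r \<ge> 1"
  shows "continuous_on {0..pi / real (r + 1)} (loop r)"
proof -
  let ?a = "pi / real (r + 1)"
  let ?f = "\<lambda>\<phi>. of_real (sin \<phi> / sin (real r * \<phi>)) * cis (real (r + 1) * \<phi>)"
  have "(loop r \<longlongrightarrow> loop r \<phi>) (at \<phi> within {0..?a})" if "\<phi> \<in> {0..?a}" for \<phi>
  proof (cases "\<phi> = 0")
    case True
    define R where "R = real r"
    have R: "R > 0" using assms by (simp add: R_def)
    have "((\<lambda>\<phi>. sin \<phi> / sin (R * \<phi>)) \<longlongrightarrow> inverse R) (at 0)"
      using R by real_asymp
    then have lim: "((\<lambda>\<phi>. sin \<phi> / sin (real r * \<phi>)) \<longlongrightarrow> 1 / real r) (at 0)"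
      by (simp only: inverse_eq_divide R_def)
    have "(?f \<longlongrightarrow> of_real (1 / real r) * cis (real (r + 1) * 0)) (at 0)"
      by (rule tendsto_mult[OF tendsto_of_real[OF lim]]) (intro tendsto_intros)
    moreover have "\<forall>\<^sub>F \<phi> in at 0. ?f \<phi> = loop r \<phi>"
      by (auto simp: eventually_at loop_def intro!: exI[of _ 1])
    ultimately have "(loop r \<longlongrightarrow> loop r 0) (at 0)"
      by (subst (asm) tendsto_cong) (auto simp: loop_def)
    then show ?thesis unfolding True by (rule tendsto_within_subset) simp
  next
    case False
    have "0 < real r * \<phi>" "real r * \<phi> < pi"
    proof -
      have "real r * \<phi> \<le> real r * ?a" using that by (intro mult_left_mono) auto
      also have "\<dots> < pi" by (simp add: field_simps)
      finally show "real r * \<phi> < pi" .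
      show "0 < real r * \<phi>" using False that assms by simp
    qed
    then have "sin (real r * \<phi>) > 0" by (rule sin_gt_zero)
    then have "(?f \<longlongrightarrow> ?f \<phi>) (at \<phi>)"
      by (intro tendsto_intros) auto
    moreover have "\<forall>\<^sub>F \<phi> in at \<phi>. ?f \<phi> = loop r \<phi>"
      using eventually_neq_at_within[of 0 \<phi>] by eventually_elim (simp add: loop_def)
    ultimately have "(loop r \<longlongrightarrow> loop r \<phi>) (at \<phi>)"
      using False by (subst (asm) tendsto_cong) (auto simp: loop_def)
    then show ?thesis by (rule tendsto_within_subset) simp
  qed
  then show ?thesis by (auto simp: continuous_on_def)
qed

text \<open>
  The imaginary part of \<open>v' / v\<close> is the derivative of the argument of \<open>v\<close>. The real part \<open>\<rho>\<close> is left
  unspecified, because only imaginary parts of integrals along the curve are computed.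
\<close>

lemma loop_has_vector_derivative:
  assumes "r \<ge> 1" "0 < \<phi>" "\<phi> < pi / real (r + 1)"
  obtains \<rho> :: real where
    "(loop r has_vector_derivative loop r \<phi> * (of_real \<rho> + \<i> * of_real (real (r + 1)))) (at \<phi>)"
proof -
  note p = sin_angle_pos[OF assms]
  define d where "d = (cos \<phi> * sin (real r * \<phi>) - sin \<phi> * (cos (real r * \<phi>) * real r)) / (sin (real r * \<phi>) * sin (real r * \<phi>))"
  define \<rho> where "\<rho> = d / (sin \<phi> / sin (real r * \<phi>))"
  have 1: "((\<lambda>\<phi>. sin \<phi> / sin (real r * \<phi>)) has_field_derivative d) (at \<phi>)"
    unfolding d_def using p by (auto intro!: derivative_eq_intros)
  have 1: "((\<lambda>\<phi>. complex_of_real (sin \<phi> / sin (real r * \<phi>))) has_vector_derivative of_real d) (at \<phi>)"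
    using has_vector_derivative_of_real[OF 1] .
  have "((\<lambda>\<phi>. real (r + 1) * \<phi>) has_derivative (\<lambda>h. real (r + 1) * h)) (at \<phi>)"
    by (auto intro!: derivative_eq_intros)
  from has_derivative_cis[OF this]
  have 2: "((\<lambda>\<phi>. cis (real (r + 1) * \<phi>)) has_vector_derivative of_real (real (r + 1)) * (\<i> * cis (real (r + 1) * \<phi>))) (at \<phi>)"
    unfolding has_vector_derivative_def by (rule has_derivative_eq_rhs) (simp add: fun_eq_iff scaleR_conv_of_real mult_ac)
  have d: "complex_of_real d = of_real (sin \<phi> / sin (real r * \<phi>)) * of_real \<rho>"
    unfolding of_real_mult[symmetric] \<rho>_def using p by simp
  have l: "loop r \<phi> = of_real (sin \<phi> / sin (real r * \<phi>)) * cis (real (r + 1) * \<phi>)"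
    using assms by (simp add: loop_def)
  have "((\<lambda>\<phi>. of_real (sin \<phi> / sin (real r * \<phi>)) * cis (real (r + 1) * \<phi>)) has_vector_derivative loop r \<phi> * (of_real \<rho> + \<i> * of_real (real (r + 1)))) (at \<phi>)"
    using has_vector_derivative_mult[OF 1 2] unfolding d l by (simp only: algebra_simps)
  then have "(loop r has_vector_derivative loop r \<phi> * (of_real \<rho> + \<i> * of_real (real (r + 1)))) (at \<phi>)"
    by (rule has_vector_derivative_transform_within_open[of _ _ _ "{0<..}"]) (use assms in \<open>auto simp: loop_def\<close>)
  then show ?thesis by (rule that)
qed

text \<open>
  Stands in for integration over the closed loop: if \<open>g\<close> is real on the real axis, the
  imaginary part of its integral along a curve between two real points vanishes. The
  finite set \<open>K\<close> leaves room for a removable singularity.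
\<close>

lemma primitive_Im_zero_on_reals:
  fixes g :: "complex \<Rightarrow> complex"
  assumes g: "g holomorphic_on ball 0 R" and fin: "finite K"
    and real: "\<And>t. \<bar>t\<bar> < R \<Longrightarrow> t \<notin> K \<Longrightarrow> Im (g (of_real t)) = 0"
  obtains G where "\<And>z. z \<in> ball 0 R \<Longrightarrow> (G has_field_derivative g z) (at z)"
    "\<And>s t. \<bar>s\<bar> < R \<Longrightarrow> \<bar>t\<bar> < R \<Longrightarrow> Im (G (of_real s)) = Im (G (of_real t))"
proof -
  obtain G where "\<And>z. z \<in> ball 0 R \<Longrightarrow> (G has_field_derivative g z) (at z within ball 0 R)"
    using holomorphic_convex_primitive'[OF convex_ball open_ball g] by blast
  then have G: "(G has_field_derivative g z) (at z)" if "z \<in> ball 0 R" for z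
    using that by (metis at_within_open open_ball)
  have vd: "((\<lambda>t. Im (G (of_real t))) has_vector_derivative Im (g (of_real t))) (at t)" if "\<bar>t\<bar> < R" for t
  proof -
    have o: "(complex_of_real has_vector_derivative 1) (at t)"
      using has_vector_derivative_of_real[OF DERIV_ident] by fastforce
    have "((G \<circ> of_real) has_vector_derivative 1 * g (of_real t)) (at t)"
      by (rule field_vector_diff_chain_at[OF o G]) (use that in simp)
    from bounded_linear.has_vector_derivative[OF bounded_linear_Im this]
    show ?thesis by (simp add: o_def)
  qed
  have "(\<lambda>t. Im (G (of_real t))) constant_on ball (0::real) R"
  proof (rule has_derivative_zero_connected_constant_on[OF connected_ball open_ball fin])
    show "continuous_on (ball 0 R) (\<lambda>t. Im (G (of_real t)))"
      by (intro continuous_at_imp_continuous_on ballI has_vector_derivative_continuous[OF vd]) (simp add: dist_real_def)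
    show "\<forall>t\<in>ball 0 R - K. ((\<lambda>t. Im (G (of_real t))) has_derivative (\<lambda>h. 0)) (at t within ball 0 R)"
    proof
      fix t assume t: "t \<in> ball 0 R - K"
      then have "\<bar>t\<bar> < R" "Im (g (of_real t)) = 0" using real by (simp_all add: dist_real_def)
      with vd[of t] show "((\<lambda>t. Im (G (of_real t))) has_derivative (\<lambda>h. 0)) (at t within ball 0 R)"
        by (auto simp: has_vector_derivative_def intro: has_derivative_at_withinI)
    qed
  qed
  then have "Im (G (of_real s)) = Im (G (of_real t))" if "\<bar>s\<bar> < R" "\<bar>t\<bar> < R" for s t
    using that unfolding constant_on_def by (metis dist_0_norm mem_ball real_norm_def)
  with G show ?thesis using that by blast
qed

text \<open>
  On the curve, \<open>(r + 1) / (1 - u xhat)\<close> is the imaginary part of \<open>v' / (v - u (1 + v)\<^sup>r\<^sup>+\<^sup>1)\<close>. The point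
  \<open>v\<^sub>0 = w - 1\<close> is a simple zero of this denominator, and for small \<open>u\<close> the only one in the disc of radius
  2. Splitting off the pole \<open>A / (v - v\<^sub>0)\<close> leaves a function that is holomorphic there and real on
  the real axis, so it contributes nothing, while the pole contributes \<open>\<pi> A\<close>, the change of
  argument of \<open>v - v\<^sub>0\<close> from 0 to \<open>\<pi>\<close> times \<open>A\<close>.
\<close>

lemma xhat_kernel_integral:
  fixes w u :: real
  assumes r: "r \<ge> 1" and w: "0 < w" "w < 1" and u: "u = (w - 1) / w ^ (r + 1)"
    and small: "\<bar>u\<bar> * (real (r + 1) * 3 ^ r) < 1"
  shows "((\<lambda>\<phi>. 1 / (1 - u * xhat r \<phi>)) has_integral pi / real (r + 1) * (w / (real (r + 1) - real r * w)))
      {0..pi / real (r + 1)}"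
proof -
  let ?a = "pi / real (r + 1)"
  define v0 where "v0 = complex_of_real (w - 1)"
  \<comment> \<open>The quotient of \<open>z - u (1 + z)\<^sup>r\<^sup>+\<^sup>1\<close> by \<open>z - v0\<close>.\<close>
  define K where "K z = 1 - of_real u * (\<Sum>i<r + 1. of_real w ^ (r - i) * (1 + z) ^ i)" for z :: complex
  define f where "f z = 1 / K z" for z
  define A where "A = w / (real (r + 1) - real r * w)"
  have u0: "u < 0" using w by (simp add: u divide_neg_pos)
  have uw: "u * w ^ (r + 1) = w - 1" using w by (simp add: u)
  have K0: "K z \<noteq> 0" if "z \<in> ball 0 2" for z
  proof -
    have "norm (1 + z) \<le> 1 + norm z" using norm_triangle_ineq[of 1 z] by simp
    then have z: "norm (1 + z) \<le> 3" using that by simp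
    have "norm (\<Sum>i<r + 1. of_real w ^ (r - i) * (1 + z) ^ i) \<le> (\<Sum>i<r + 1. 3 ^ r)"
    proof (rule sum_norm_le)
      fix i assume i: "i \<in> {..<r + 1}"
      have "norm (1 + z) ^ i \<le> 3 ^ i" using z by (intro power_mono) auto
      also have "\<dots> \<le> 3 ^ r" using i by (intro power_increasing) auto
      finally have "norm (1 + z) ^ i \<le> 3 ^ r" .
      moreover have "w ^ (r - i) \<le> 1" using w by (intro power_le_one) auto
      ultimately have "w ^ (r - i) * norm (1 + z) ^ i \<le> 1 * 3 ^ r"
        using w by (intro mult_mono) auto
      then show "norm (of_real w ^ (r - i) * (1 + z) ^ i) \<le> 3 ^ r"
        using w by (simp add: norm_mult norm_power)
    qed
    then have "norm (of_real u * (\<Sum>i<r + 1. of_real w ^ (r - i) * (1 + z) ^ i)) \<le> \<bar>u\<bar> * (real (r + 1) * 3 ^ r)"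
      unfolding norm_mult by (intro mult_mono) auto
    then have "norm (of_real u * (\<Sum>i<r + 1. of_real w ^ (r - i) * (1 + z) ^ i)) < norm (1 :: complex)"
      using small by simp
    then show ?thesis unfolding K_def by auto
  qed
  have factor: "(z - v0) * K z = z - of_real u * (1 + z) ^ (r + 1)" for z
  proof -
    have "(1 + z) ^ Suc r - of_real w ^ Suc r = (1 + z - of_real w) * (\<Sum>i<Suc r. of_real w ^ (Suc r - Suc i) * (1 + z) ^ i)"
      by (rule power_diff_sumr2)
    then have "(1 + z) ^ (r + 1) - of_real w ^ (r + 1) = (z - v0) * (\<Sum>i<r + 1. of_real w ^ (r - i) * (1 + z) ^ i)"
      by (simp add: v0_def algebra_simps del: power_Suc sum.lessThan_Suc)
    moreover have "of_real u * of_real w ^ (r + 1) = v0"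
      unfolding v0_def uw[symmetric] by simp
    ultimately have "of_real u * (1 + z) ^ (r + 1) - v0 = of_real u * ((z - v0) * (\<Sum>i<r + 1. of_real w ^ (r - i) * (1 + z) ^ i))"
      by (metis right_diff_distrib)
    then have "v0 + of_real u * ((z - v0) * (\<Sum>i<r + 1. of_real w ^ (r - i) * (1 + z) ^ i)) = of_real u * (1 + z) ^ (r + 1)"
      by (simp only: diff_eq_eq add.commute)
    moreover have "(z - v0) * (1 - U * X) = z - (v0 + U * ((z - v0) * X))" for U X :: complex
      by (simp add: algebra_simps)
    ultimately show ?thesis unfolding K_def by simp
  qed
  have fA: "f v0 = of_real A"
  proof -
    have "K v0 = 1 - of_real (u * (real (r + 1) * w ^ r))"
      by (simp add: K_def v0_def power_add[symmetric] del: sum.lessThan_Suc)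
    also have "u * (real (r + 1) * w ^ r) = real (r + 1) * (w - 1) / w"
      using w by (simp add: u)
    finally have "K v0 = of_real (1 - real (r + 1) * (w - 1) / w)" by simp
    also have "1 - real (r + 1) * (w - 1) / w = (real (r + 1) - real r * w) / w"
      using w by (simp add: field_simps)
    finally show ?thesis by (simp add: f_def A_def)
  qed
  have fh: "f holomorphic_on ball 0 2"
    unfolding f_def K_def by (intro holomorphic_intros) (use K0 in \<open>simp add: K_def\<close>)
  define g where "g = (\<lambda>z. if z = v0 then deriv f v0 else (f z - f v0) / (z - v0))"
  have gh: "g holomorphic_on ball 0 2"
    unfolding g_def by (rule pole_lemma_open[OF fh open_ball])
  have "Im (g (of_real t)) = 0" if "t \<notin> {w - 1}" for t
  proof -
    have "K (of_real t) = of_real (1 - u * (\<Sum>i<r + 1. w ^ (r - i) * (1 + t) ^ i))"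
      by (simp add: K_def del: sum.lessThan_Suc)
    then have "f (of_real t) = of_real (1 / (1 - u * (\<Sum>i<r + 1. w ^ (r - i) * (1 + t) ^ i)))"
      by (simp only: f_def of_real_divide of_real_1)
    moreover have "of_real t \<noteq> v0" using that by (simp add: v0_def del: of_real_diff)
    ultimately have "g (of_real t) = of_real ((1 / (1 - u * (\<Sum>i<r + 1. w ^ (r - i) * (1 + t) ^ i)) - A) / (t - (w - 1)))"
      unfolding g_def fA by (simp only: if_False v0_def of_real_diff of_real_divide)
    then show ?thesis by (simp only: Im_complex_of_real)
  qed
  then obtain G where G: "\<And>z. z \<in> ball 0 2 \<Longrightarrow> (G has_field_derivative g z) (at z)"
    and Gr: "\<And>s t. \<bar>s\<bar> < 2 \<Longrightarrow> \<bar>t\<bar> < 2 \<Longrightarrow> Im (G (of_real s)) = Im (G (of_real t))"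
    using primitive_Im_zero_on_reals[OF gh, of "{w - 1}"] by blast
  \<comment> \<open>The factor \<open>- \<i>\<close> moves the branch cut of the logarithm away from the curve and its two end points.\<close>
  define T where "T z = Im (G z + of_real A * Ln (- \<i> * (z - v0)))" for z
  have nr: "- \<i> * (loop r \<phi> - v0) \<notin> \<real>\<^sub>\<le>\<^sub>0" if p: "0 \<le> \<phi>" "\<phi> \<le> ?a" for \<phi>
  proof -
    consider "\<phi> = 0" | "\<phi> = ?a" | "0 < \<phi>" "\<phi> < ?a" using p by linarith
    then show ?thesis
    proof cases
      case 1
      have "0 < 1 / real r" using r by simp
      then have "w - 1 \<noteq> 1 / real r" using w by linarith
      with 1 show ?thesis by (auto simp: loop_def v0_def complex_nonpos_Reals_iff)
    next
      case 2
      then show ?thesis using w unfolding 2 loop_end[OF r] by (auto simp: v0_def complex_nonpos_Reals_iff)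
    next
      case 3
      then show ?thesis using Im_loop_pos[OF r 3] by (auto simp: v0_def complex_nonpos_Reals_iff)
    qed
  qed
  \<comment> \<open>The radius 2 leaves a margin around the closed unit disc, which contains the curve.\<close>
  have inb: "loop r \<phi> \<in> ball 0 2" if "0 \<le> \<phi>" "\<phi> \<le> ?a" for \<phi>
    using norm_loop_le[OF r that] by simp
  have cont: "continuous_on {0..?a} (\<lambda>\<phi>. T (loop r \<phi>))"
  proof -
    have "continuous_on (ball 0 2) G" using G DERIV_isCont by (blast intro: continuous_at_imp_continuous_on)
    then have "continuous_on {0..?a} (\<lambda>\<phi>. G (loop r \<phi>))"
      by (rule continuous_on_compose2[OF _ continuous_on_loop[OF r]]) (use inb in auto)
    then show ?thesis unfolding T_def
      by (intro continuous_intros continuous_on_loop[OF r]) (use nr in auto)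
  qed
  have der: "((\<lambda>\<phi>. T (loop r \<phi>)) has_vector_derivative real (r + 1) * (1 / (1 - u * xhat r \<phi>))) (at \<phi>)"
    if p: "\<phi> \<in> {0<..<?a}" for \<phi>
  proof -
    have p': "0 < \<phi>" "\<phi> < ?a" using p by auto
    let ?v = "loop r \<phi>"
    obtain \<rho> where d: "(loop r has_vector_derivative ?v * (of_real \<rho> + \<i> * of_real (real (r + 1)))) (at \<phi>)"
      using loop_has_vector_derivative[OF r p'] by blast
    have ne: "?v \<noteq> v0" "?v \<noteq> 0" using Im_loop_pos[OF r p'] by (auto simp: v0_def)
    have nr': "- \<i> * (?v - v0) \<notin> \<real>\<^sub>\<le>\<^sub>0" using nr p' by simp
    have inb': "?v \<in> ball 0 2" using inb p' by simp
    have x: "1 - u * xhat r \<phi> > 0" using u0 xhat_pos[OF r p'] mult_neg_pos[of u "xhat r \<phi>"] by linarith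
    have "((\<lambda>z. G z + of_real A * Ln (- \<i> * (z - v0))) has_field_derivative g ?v + of_real A * (1 / (?v - v0))) (at ?v)"
      by (rule derivative_eq_intros G[OF inb'] refl nr')+ (use ne in \<open>simp add: field_simps\<close>)
    also have "g ?v + of_real A * (1 / (?v - v0)) = f ?v / (?v - v0)"
      using ne by (simp add: g_def fA diff_divide_distrib)
    also have "\<dots> = 1 / ((?v - v0) * K ?v)" by (simp add: f_def)
    also have "(?v - v0) * K ?v = ?v * of_real (1 - u * xhat r \<phi>)"
      unfolding factor loop_power_xhat[OF r p'] by (simp add: algebra_simps)
    finally have "((\<lambda>z. G z + of_real A * Ln (- \<i> * (z - v0))) has_field_derivative 1 / (?v * of_real (1 - u * xhat r \<phi>))) (at ?v)" .
    from bounded_linear.has_vector_derivative[OF bounded_linear_Im field_vector_diff_chain_at[OF d this]]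
    have "((\<lambda>\<phi>. T (loop r \<phi>)) has_vector_derivative
        Im (?v * (of_real \<rho> + \<i> * of_real (real (r + 1))) * (1 / (?v * of_real (1 - u * xhat r \<phi>))))) (at \<phi>)"
      by (simp add: T_def o_def)
    also have "?v * (of_real \<rho> + \<i> * of_real (real (r + 1))) * (1 / (?v * of_real (1 - u * xhat r \<phi>)))
        = (of_real \<rho> + \<i> * of_real (real (r + 1))) / of_real (1 - u * xhat r \<phi>)"
      using ne by simp
    also have "Im \<dots> = real (r + 1) * (1 / (1 - u * xhat r \<phi>))"
      unfolding Im_divide_of_real by simp
    finally show ?thesis .
  qed
  have a0: "0 \<le> ?a" by simp
  have I: "((\<lambda>\<phi>. real (r + 1) * (1 / (1 - u * xhat r \<phi>))) has_integral T (loop r ?a) - T (loop r 0)) {0..?a}"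
    by (rule fundamental_theorem_of_calculus_interior[OF a0 cont der])
  have "T (loop r ?a) - T (loop r 0) = A * pi"
  proof -
    have 1: "- \<i> * (loop r ?a - v0) = of_real w * \<i>"
      unfolding loop_end[OF r] v0_def by (simp add: algebra_simps)
    have 2: "- \<i> * (loop r 0 - v0) = of_real (1 / real r + 1 - w) * (- \<i>)"
      unfolding loop_def v0_def by (simp add: algebra_simps)
    have ln: "Im (Ln (of_real c * \<i>)) = pi / 2" "Im (Ln (of_real c * (- \<i>))) = - (pi / 2)" if "c > 0" for c
    proof -
      have "Ln (of_real c * z) = of_real (ln c) + Ln z" if "z \<noteq> 0" for z
        using Ln_times_of_real[OF \<open>c > 0\<close> that] Ln_of_real[OF \<open>c > 0\<close>] by simp
      from this[of \<i>] this[of "- \<i>"] show "Im (Ln (of_real c * \<i>)) = pi / 2" "Im (Ln (of_real c * (- \<i>))) = - (pi / 2)"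
        by simp_all
    qed
    have "0 < 1 / real r" using r by simp
    then have "1 / real r + 1 - w > 0" using w by linarith
    note ln(1)[OF w(1)] ln(2)[OF this]
    moreover have "Im (G (loop r ?a)) = Im (G (loop r 0))"
    proof -
      have "1 / real r \<le> 1" using r by simp
      then have "\<bar>1 / real r\<bar> < 2" using \<open>0 < 1 / real r\<close> by linarith
      with Gr[of "-1" "1 / real r"] show ?thesis unfolding loop_end[OF r] by (simp add: loop_def)
    qed
    moreover have "T z = Im (G z) + A * Im (Ln (- \<i> * (z - v0)))" for z
      by (simp add: T_def)
    ultimately have "T (loop r ?a) - T (loop r 0)
        = Im (G (loop r 0)) + A * (pi / 2) - (Im (G (loop r 0)) + A * (- (pi / 2)))"
      by (simp only: 1 2)
    then show ?thesis by simp
  qed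
  with I have "((\<lambda>\<phi>. 1 / real (r + 1) * (real (r + 1) * (1 / (1 - u * xhat r \<phi>)))) has_integral 1 / real (r + 1) * (A * pi)) {0..?a}"
    by (intro has_integral_mult_right) simp
  then show ?thesis unfolding A_def by (simp add: mult_ac del: of_nat_add)
qed

section \<open>From kernels to continuous functions\<close>

text \<open>
  Only linearity and the sup norm bound are used of the averages, both for the zeros and for the
  limit density. Linearity is required on continuous functions only, since integrals of
  other functions may not exist.
\<close>

definition mean_functional :: "((real \<Rightarrow> real) \<Rightarrow> real) \<Rightarrow> bool" where
  "mean_functional L \<longleftrightarrow>
     (\<forall>f g a b. continuous_on {0..1} f \<longrightarrow> continuous_on {0..1} g \<longrightarrow>
        L (\<lambda>t. a * f t + b * g t) = a * L f + b * L g) \<and>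
     (\<forall>f e. continuous_on {0..1} f \<longrightarrow> (\<forall>t\<in>{0..1}. \<bar>f t\<bar> \<le> e) \<longrightarrow> \<bar>L f\<bar> \<le> e)"

lemma mean_functional_linear:
  "mean_functional L \<Longrightarrow> continuous_on {0..1} f \<Longrightarrow> continuous_on {0..1} g \<Longrightarrow>
     L (\<lambda>t. a * f t + b * g t) = a * L f + b * L g"
  unfolding mean_functional_def by blast

lemma mean_functional_dist:
  assumes "mean_functional L" "continuous_on {0..1} f" "continuous_on {0..1} g"
    "\<And>t. t \<in> {0..1} \<Longrightarrow> \<bar>f t - g t\<bar> \<le> e"
  shows "\<bar>L f - L g\<bar> \<le> e"
proof -
  have "L (\<lambda>t. 1 * f t + (-1) * g t) = 1 * L f + (-1) * L g"
    by (rule mean_functional_linear[OF assms(1-3)])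
  then have "L f - L g = L (\<lambda>t. f t - g t)" by simp
  moreover have "continuous_on {0..1} (\<lambda>t. f t - g t)" by (intro continuous_intros assms)
  ultimately show ?thesis using assms(1,4) unfolding mean_functional_def by simp
qed

text \<open>
  The functions \<open>f\<close> for which the averages converge form a linear space that is closed under uniform
  limits. It contains \<open>t\<^sup>m\<close> and \<open>t\<^sup>m y / (y + t)\<close> for all \<open>m\<close> by induction: the identity
  \<open>t\<^sup>m\<^sup>+\<^sup>1 y / (y + t) = y t\<^sup>m - y t\<^sup>m y / (y + t)\<close> raises the power, and \<open>y \<rightarrow> \<infinity>\<close> recovers the monomial.
\<close>

lemma mean_functionals_converge:
  fixes M :: "nat \<Rightarrow> (real \<Rightarrow> real) \<Rightarrow> real"
  assumes M: "\<And>n. mean_functional (M n)" and I: "mean_functional I"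
    and one: "(\<lambda>n. M n (\<lambda>_. 1)) \<longlonglongrightarrow> I (\<lambda>_. 1)"
    and y0: "y0 > 0"
    and kernel: "\<And>y. y > y0 \<Longrightarrow> (\<lambda>n. M n (\<lambda>t. y / (y + t))) \<longlonglongrightarrow> I (\<lambda>t. y / (y + t))"
    and f: "continuous_on {0..1} f"
  shows "(\<lambda>n. M n f) \<longlonglongrightarrow> I f"
proof -
  define good where "good f \<longleftrightarrow> continuous_on {0..1} f \<and> (\<lambda>n. M n f) \<longlonglongrightarrow> I f" for f
  have lin: "good (\<lambda>t. a * f t + b * g t)" if "good f" "good g" for f g a b
  proof -
    have c: "continuous_on {0..1} f" "continuous_on {0..1} g" using that by (simp_all add: good_def)
    have "(\<lambda>n. a * M n f + b * M n g) \<longlonglongrightarrow> a * I f + b * I g"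
      using that by (intro tendsto_intros) (simp_all add: good_def)
    moreover have "continuous_on {0..1} (\<lambda>t. a * f t + b * g t)" by (intro continuous_intros c)
    ultimately show ?thesis
      unfolding good_def mean_functional_linear[OF M c] mean_functional_linear[OF I c] by blast
  qed
  have closed: "good f" if f: "continuous_on {0..1} f"
    and approx: "\<And>e. e > 0 \<Longrightarrow> \<exists>g. good g \<and> (\<forall>t\<in>{0..1}. \<bar>f t - g t\<bar> \<le> e)" for f
  proof -
    have "(\<lambda>n. M n f) \<longlonglongrightarrow> I f"
    proof (rule LIMSEQ_I)
      fix e :: real assume "e > 0"
      then have e: "e / 3 > 0" by simp
      from approx[OF e] obtain g where g: "good g" "\<And>t. t \<in> {0..1} \<Longrightarrow> \<bar>f t - g t\<bar> \<le> e / 3" by blast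
      have c: "continuous_on {0..1} g" using g by (simp add: good_def)
      from g(1) have "(\<lambda>n. M n g) \<longlonglongrightarrow> I g" by (simp add: good_def)
      from LIMSEQ_D[OF this e] obtain n0 where n0: "\<And>n. n \<ge> n0 \<Longrightarrow> norm (M n g - I g) < e / 3" by blast
      have "norm (M n f - I f) < e" if "n \<ge> n0" for n
        using mean_functional_dist[OF M f c g(2), of n] mean_functional_dist[OF I f c g(2)] n0[OF that]
        unfolding real_norm_def by linarith
      then show "\<exists>no. \<forall>n\<ge>no. norm (M n f - I f) < e" by blast
    qed
    with f show ?thesis by (simp add: good_def)
  qed
  have pow: "good (\<lambda>t. t ^ m) \<and> (\<forall>y>y0. good (\<lambda>t. t ^ m * (y / (y + t))))" for m
  proof (induction m)
    case 0
    have "continuous_on {0..1} (\<lambda>t. y / (y + t))" if "y > y0" for y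
      using that y0 by (intro continuous_intros) auto
    then show ?case using one kernel by (simp add: good_def)
  next
    case (Suc m)
    have k: "good (\<lambda>t. t ^ Suc m * (y / (y + t)))" if y: "y > y0" for y
    proof -
      have "good (\<lambda>t. y * t ^ m + (- y) * (t ^ m * (y / (y + t))))"
        using Suc y by (intro lin) auto
      moreover have c: "continuous_on {0..1} (\<lambda>t. t ^ Suc m * (y / (y + t)))"
        using y y0 by (intro continuous_intros) auto
      moreover have "y * t ^ m + (- y) * (t ^ m * (y / (y + t))) = t ^ Suc m * (y / (y + t))" if "t \<in> {0..1}" for t
        using that y y0 by (simp add: field_simps)
      ultimately show ?thesis
        by (intro closed exI[of _ "\<lambda>t. y * t ^ m + (- y) * (t ^ m * (y / (y + t)))"]) auto
    qed
    have "good (\<lambda>t. t ^ Suc m)"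
    proof (rule closed)
      fix e :: real assume e: "e > 0"
      \<comment> \<open>The kernel approximation of \<open>t\<^sup>m\<^sup>+\<^sup>1\<close> is uniform with error at most \<open>1/y\<close>.\<close>
      define y where "y = max (y0 + 1) (1 / e)"
      have y: "y > y0" "y > 0" "1 / y \<le> e"
        using y0 e by (auto simp: y_def max_def field_simps)
      have "\<bar>t ^ Suc m - t ^ Suc m * (y / (y + t))\<bar> \<le> e" if t: "t \<in> {0..1}" for t
      proof -
        have "t ^ Suc m - t ^ Suc m * (y / (y + t)) = t ^ Suc m * (t / (y + t))"
          using y t by (simp add: field_simps)
        moreover have "0 \<le> t ^ Suc m" "t ^ Suc m \<le> 1" using t by (auto intro!: power_le_one simp del: power_Suc)
        moreover have "0 \<le> t / (y + t)" using y t by simp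
        moreover have "t / (y + t) \<le> 1 / y" using y t by (intro frac_le) auto
        ultimately have "\<bar>t ^ Suc m - t ^ Suc m * (y / (y + t))\<bar> \<le> 1 * (1 / y)"
          by (simp only: abs_mult abs_of_nonneg mult_mono zero_le_one)
        then show ?thesis using y(3) by linarith
      qed
      then show "\<exists>g. good g \<and> (\<forall>t\<in>{0..1}. \<bar>t ^ Suc m - g t\<bar> \<le> e)"
        using k[OF y(1)] by blast
    qed (intro continuous_intros)
    with k show ?case by blast
  qed
  have poly: "good (\<lambda>t. \<Sum>i\<le>d. a i * t ^ i)" for a :: "nat \<Rightarrow> real" and d
  proof (induction d)
    case 0
    show ?case using lin[of "\<lambda>t. t ^ 0" "\<lambda>t. t ^ 0" "a 0" 0] pow[of 0] by simp
  next
    case (Suc d)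
    show ?case using lin[OF Suc conjunct1[OF pow[of "Suc d"]], of 1 "a (Suc d)"] by simp
  qed
  have "good f"
  proof (rule closed[OF f])
    fix e :: real assume "e > 0"
    then obtain p where p: "real_polynomial_function p" "\<And>t. t \<in> {0..1} \<Longrightarrow> \<bar>f t - p t\<bar> < e"
      using Stone_Weierstrass_real_polynomial_function[of "{0..1::real}" f e] f by auto
    then show "\<exists>g. good g \<and> (\<forall>t\<in>{0..1}. \<bar>f t - g t\<bar> \<le> e)"
      using poly unfolding real_polynomial_function_iff_sum by (metis less_imp_le)
  qed
  then show ?thesis by (simp add: good_def)
qed

lemma mean_functional_average:
  assumes "\<And>k. k \<in> {1..N} \<Longrightarrow> x k \<in> {0..1}"
  shows "mean_functional (\<lambda>f. 1 / real N * (\<Sum>k=1..N. f (x k)))"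
  unfolding mean_functional_def
proof (intro conjI allI impI)
  fix f :: "real \<Rightarrow> real" and e assume e: "\<forall>t\<in>{0..1}. \<bar>f t\<bar> \<le> e"
  then have e0: "0 \<le> e" by (meson abs_ge_zero atLeastAtMost_iff order_refl order_trans zero_le_one)
  have "\<bar>\<Sum>k=1..N. f (x k)\<bar> \<le> (\<Sum>k=1..N. \<bar>f (x k)\<bar>)" by (rule sum_abs)
  also have "\<dots> \<le> real (card {1..N}) * e"
    by (rule sum_bounded_above) (use e assms in blast)
  finally show "\<bar>1 / real N * (\<Sum>k=1..N. f (x k))\<bar> \<le> e"
    using e0 by (cases "N = 0") (simp_all add: abs_mult field_simps)
qed (simp add: sum.distrib sum_distrib_left algebra_simps)

lemma mean_functional_xhat:
  assumes r: "r \<ge> 1"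
  shows "mean_functional (\<lambda>f. real (r + 1) / pi * integral {0<..<pi / real (r + 1)} (\<lambda>\<phi>. f (xhat r \<phi> / c_const r)))"
  unfolding mean_functional_def
proof (intro conjI allI impI)
  let ?S = "{0<..<pi / real (r + 1)}"
  fix f g :: "real \<Rightarrow> real" and a b assume c: "continuous_on {0..1} f" "continuous_on {0..1} g"
  note i = v_dens_integral(2)[OF r c(1)] v_dens_integral(2)[OF r c(2)]
  have "integral ?S (\<lambda>\<phi>. a * f (xhat r \<phi> / c_const r) + b * g (xhat r \<phi> / c_const r))
      = integral ?S (\<lambda>\<phi>. a * f (xhat r \<phi> / c_const r)) + integral ?S (\<lambda>\<phi>. b * g (xhat r \<phi> / c_const r))"
    by (rule integral_add) (intro integrable_on_mult_right i)+
  then show "real (r + 1) / pi * integral ?S (\<lambda>\<phi>. a * f (xhat r \<phi> / c_const r) + b * g (xhat r \<phi> / c_const r))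
      = a * (real (r + 1) / pi * integral ?S (\<lambda>\<phi>. f (xhat r \<phi> / c_const r)))
        + b * (real (r + 1) / pi * integral ?S (\<lambda>\<phi>. g (xhat r \<phi> / c_const r)))"
    unfolding integral_mult_right by (simp only: distrib_left mult.left_commute)
next
  let ?S = "{0<..<pi / real (r + 1)}"
  fix f :: "real \<Rightarrow> real" and e assume c: "continuous_on {0..1} f" and e: "\<forall>t\<in>{0..1}. \<bar>f t\<bar> \<le> e"
  have "norm (integral ?S (\<lambda>\<phi>. f (xhat r \<phi> / c_const r))) \<le> integral ?S (\<lambda>\<phi>. e)"
  proof (rule integral_norm_bound_integral[OF v_dens_integral(2)[OF r c]])
    show "(\<lambda>\<phi>. e) integrable_on ?S" by (rule integrable_on_const) simp
    fix \<phi> assume "\<phi> \<in> ?S"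
    then have "xhat r \<phi> \<in> {0<..<c_const r}" unfolding xhat_image[OF r, symmetric] by (rule imageI)
    then show "norm (f (xhat r \<phi> / c_const r)) \<le> e" using e by simp
  qed
  also have "integral ?S (\<lambda>\<phi>. e) = e * (pi / real (r + 1))"
    by (simp add: integral_open_interval_real[symmetric] mult.commute)
  finally have "real (r + 1) / pi * \<bar>integral ?S (\<lambda>\<phi>. f (xhat r \<phi> / c_const r))\<bar> \<le> real (r + 1) / pi * (e * (pi / real (r + 1)))"
    by (intro mult_left_mono) auto
  then show "\<bar>real (r + 1) / pi * integral ?S (\<lambda>\<phi>. f (xhat r \<phi> / c_const r))\<bar> \<le> e"
    by (simp add: abs_mult del: of_nat_add)
qed

section \<open>The zero distribution\<close>

lemma xhat_kernel_mean:
  fixes w y :: real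
  assumes r: "r \<ge> 1" and w: "0 < w" "w < 1" and y: "y > 0" "w ^ (r + 1) = c_const r * y * (1 - w)"
    and large: "real (r + 1) * 3 ^ r / c_const r < y"
  shows "real (r + 1) / pi * integral {0<..<pi / real (r + 1)} (\<lambda>\<phi>. y / (y + xhat r \<phi> / c_const r))
    = w / (real (r + 1) - real r * w)"
proof -
  let ?a = "pi / real (r + 1)"
  define u where "u = - 1 / (c_const r * y)"
  have c: "c_const r > 0" by (rule c_const_pos[OF r])
  have "u * w ^ (r + 1) = w - 1"
    unfolding y(2) u_def using c y(1) by (simp add: field_simps)
  then have u: "u = (w - 1) / w ^ (r + 1)"
    using w by (simp add: eq_divide_eq)
  have small: "\<bar>u\<bar> * (real (r + 1) * 3 ^ r) < 1"
    unfolding u_def using large c y(1) by (simp add: field_simps abs_mult)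
  have "integral {0<..<?a} (\<lambda>\<phi>. y / (y + xhat r \<phi> / c_const r)) = integral {0<..<?a} (\<lambda>\<phi>. 1 / (1 - u * xhat r \<phi>))"
  proof (rule integral_cong)
    fix \<phi> assume "\<phi> \<in> {0<..<?a}"
    then have "xhat r \<phi> > 0" by (intro xhat_pos[OF r]) auto
    then show "y / (y + xhat r \<phi> / c_const r) = 1 / (1 - u * xhat r \<phi>)"
      using c y(1) by (simp add: u_def divide_simps add_pos_pos mult.commute)
  qed
  also have "\<dots> = ?a * (w / (real (r + 1) - real r * w))"
    using xhat_kernel_integral[OF r w u small] by (simp only: integral_open_interval_real[symmetric] integral_unique)
  finally show ?thesis by (simp del: of_nat_add)
qed

text \<open>
  With \<open>c\<^sub>r y\<close> in place of \<open>y\<close> this parametrizes all points \<open>x = -y\<close> of the negative axis by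
  \<open>c\<^sub>r x = w\<^sup>r\<^sup>+\<^sup>1 / (w - 1)\<close>.
\<close>

lemma exists_kernel_parameter:
  fixes y :: real
  assumes "y > 0"
  obtains w where "0 < w" "w < 1" "w ^ (r + 1) = y * (1 - w)"
proof -
  let ?f = "\<lambda>w. w ^ (r + 1) - y * (1 - w)"
  have "\<exists>w\<ge>0. w \<le> 1 \<and> ?f w = 0"
    by (rule IVT') (use assms in \<open>auto intro!: continuous_intros\<close>)
  then obtain w where w: "0 \<le> w" "w \<le> 1" "?f w = 0" by blast
  moreover have "w \<noteq> 0" "w \<noteq> 1" using w(3) assms by auto
  ultimately show ?thesis using that[of w] by simp
qed

text \<open>
  In terms of \<open>w\<close> the root of the limit equation is rational; \<open>w = (1 + 1/r) H / (H + 1)\<close> is the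
  inverse transformation.
\<close>

lemma kernel_root_identity:
  fixes w y :: real
  assumes r: "r \<ge> 1" and w: "0 < w" "w < 1" and y: "w ^ (r + 1) = c_const r * y * (1 - w)"
  defines "H \<equiv> real r * w / (real (r + 1) - real r * w)"
  shows "0 \<le> H" "H ^ Suc r = - y * ((H - real r) * (H + 1) ^ r)"
proof -
  define d where "d = real (r + 1) - real r * w"
  have "real r * w \<le> real r" using w by (simp add: mult_left_le)
  then have d: "d > 0" by (simp add: d_def)
  have H: "H = real r * w / d" by (simp add: H_def d_def)
  show "0 \<le> H" unfolding H using d w by simp
  have 1: "H + 1 = real (r + 1) / d" and 2: "H - real r = real r * real (r + 1) * (w - 1) / d"
    unfolding H using d by (simp_all add: d_def field_simps)
  have "real r ^ r * w ^ (r + 1) = real (r + 1) ^ (r + 1) * y * (1 - w)"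
    unfolding y c_const_def using r by simp
  then have "real r * (real r ^ r * w ^ (r + 1)) = real r * (real (r + 1) ^ (r + 1) * y * (1 - w))"
    by simp
  then have k: "(real r * w) ^ Suc r = - y * (real r * real (r + 1) * (w - 1) * real (r + 1) ^ r)"
    by (simp add: power_mult_distrib algebra_simps)
  have "H ^ Suc r = (real r * w) ^ Suc r / d ^ Suc r" by (simp only: H power_divide)
  also have "\<dots> = - y * (real r * real (r + 1) * (w - 1) / d * (real (r + 1) / d) ^ r)"
    unfolding k power_divide by simp
  finally show "H ^ Suc r = - y * ((H - real r) * (H + 1) ^ r)" unfolding 1 2 .
qed

text \<open>
  Both limits of kernel averages are computed with the same parameter \<open>w\<close>: for the zeros the value is
  \<open>H / r\<close>, for the density it is \<open>w / (r + 1 - r w)\<close>, and these agree.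
\<close>

theorem theorem1p1:
  fixes r :: nat and \<alpha> :: "nat \<Rightarrow> real" and \<beta> :: real
    and P :: "nat \<Rightarrow> real poly" and x :: "nat \<Rightarrow> nat \<Rightarrow> real"
  assumes "r \<ge> 1" and "\<beta> > -1"
    and "\<And>j. j \<in> {1..r} \<Longrightarrow> \<alpha> j > -1"
    and "\<And>i j. i \<in> {1..r} \<Longrightarrow> j \<in> {1..r} \<Longrightarrow> i \<noteq> j \<Longrightarrow> \<alpha> i - \<alpha> j \<notin> \<int>"
    and "\<And>n. n \<ge> 1 \<Longrightarrow> jacobi_pineiro r \<alpha> \<beta> (\<lambda>_. n) (P n)"
    and "\<And>n. n \<ge> 1 \<Longrightarrow> strict_mono_on {1..r * n} (x n)"
    and "\<And>n. n \<ge> 1 \<Longrightarrow> x n ` {1..r * n} = {z. poly (P n) z = 0}"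
    and "\<And>n k. n \<ge> 1 \<Longrightarrow> k \<in> {1..r * n} \<Longrightarrow> 0 < x n k \<and> x n k < 1"
  shows "(\<forall>f :: real \<Rightarrow> real. continuous_on {0..1} f \<longrightarrow>
            (\<lambda>n. 1 / real (r * n) * (\<Sum>k=1..r * n. f (x n k)))
              \<longlonglongrightarrow> (LBINT t:{0..1}. f t * v_dens r t)) \<and>
         (\<forall>\<phi>\<in>{0<..<pi / real (r + 1)}.
            w_dens r (xhat r \<phi>) = real (r + 1) / pi * (1 / \<bar>deriv (xhat r) \<phi>\<bar>) \<and>
            w_dens r (xhat r \<phi>) =
              real (r + 1) / (pi * xhat r \<phi>) *
              (sin \<phi> * sin (real r * \<phi>) * sin (real (r + 1) * \<phi>) /
               (real (r + 1) ^ 2 * sin (real r * \<phi>) ^ 2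
                - 2 * real r * real (r + 1) * sin (real (r + 1) * \<phi>) * sin (real r * \<phi>) * cos \<phi>
                + real r ^ 2 * sin (real (r + 1) * \<phi>) ^ 2)))"
proof (intro conjI allI impI ballI)
  note r = \<open>r \<ge> 1\<close>
  fix \<phi> assume \<phi>: "\<phi> \<in> {0<..<pi / real (r + 1)}"
  show "w_dens r (xhat r \<phi>) = real (r + 1) / pi * (1 / \<bar>deriv (xhat r) \<phi>\<bar>)"
    by (rule w_dens_xhat[OF r \<phi>])
  show "w_dens r (xhat r \<phi>) =
              real (r + 1) / (pi * xhat r \<phi>) *
              (sin \<phi> * sin (real r * \<phi>) * sin (real (r + 1) * \<phi>) /
               (real (r + 1) ^ 2 * sin (real r * \<phi>) ^ 2
                - 2 * real r * real (r + 1) * sin (real (r + 1) * \<phi>) * sin (real r * \<phi>) * cos \<phi>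
                + real r ^ 2 * sin (real (r + 1) * \<phi>) ^ 2))"
    using w_dens_xhat_explicit[OF r \<phi>] unfolding xhat_denom_def .
next
  note r = \<open>r \<ge> 1\<close>
  fix f :: "real \<Rightarrow> real" assume f: "continuous_on {0..1} f"
  define M where "M n f = 1 / real (r * n) * (\<Sum>k=1..r * n. f (x n k))" for n and f :: "real \<Rightarrow> real"
  define I where "I f = real (r + 1) / pi * integral {0<..<pi / real (r + 1)} (\<lambda>\<phi>. f (xhat r \<phi> / c_const r))"
    for f :: "real \<Rightarrow> real"
  have c: "c_const r > 0" by (rule c_const_pos[OF r])
  have P: "poly (P n) z = (\<Prod>k=1..r * n. z - x n k)" if n: "n \<ge> 1" for n z
  proof -
    let ?K = "{1..r * n}"
    let ?p = "\<Prod>k\<in>?K. [:- x n k, 1:]"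
    have d: "degree (P n) = r * n" "coeff (P n) (r * n) = 1"
      using assms(5)[OF n] unfolding jacobi_pineiro_def by (auto simp del: One_nat_def)
    have "P n = smult (coeff (P n) (r * n)) ?p"
    proof (rule poly_eq_smult_of_roots[where S = "x n ` ?K"])
      show "degree (P n) \<le> r * n" using d by simp
      show "degree ?p = r * n" by (subst degree_prod_eq_sum_degree) auto
      show "lead_coeff ?p = 1" by (simp add: lead_coeff_prod)
      show "finite (x n ` ?K)" by simp
      show "card (x n ` ?K) = r * n"
        using card_image[OF strict_mono_on_imp_inj_on[OF assms(6)[OF n]]] by simp
      show "poly (P n) s = 0" if "s \<in> x n ` ?K" for s
        using that unfolding assms(7)[OF n] by simp
      show "poly ?p s = 0" if "s \<in> x n ` ?K" for s
        using that by (auto simp: poly_prod)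
    qed
    also have "smult (coeff (P n) (r * n)) ?p = ?p" using d(2) by simp
    finally show ?thesis by (simp add: poly_prod)
  qed
  have "(\<lambda>n. M n f) \<longlonglongrightarrow> I f"
  proof (rule mean_functionals_converge[where M = M and I = I and ?y0.0 = "real (r + 1) * 3 ^ r / c_const r"])
    show "mean_functional (M n)" for n
      unfolding M_def[abs_def]
    proof (rule mean_functional_average)
      fix k assume k: "k \<in> {1..r * n}"
      then have "n \<ge> 1" by (cases n) auto
      then show "x n k \<in> {0..1}" using assms(8)[OF _ k] by auto
    qed
    show "mean_functional I" unfolding I_def[abs_def] by (rule mean_functional_xhat[OF r])
    have "I (\<lambda>_. 1) = 1"
      by (simp add: I_def integral_open_interval_real[symmetric] del: of_nat_add)
    moreover have "\<forall>\<^sub>F n in sequentially. M n (\<lambda>_. 1) = 1"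
      using eventually_ge_at_top[of 1] by eventually_elim (use r in \<open>simp add: M_def\<close>)
    ultimately show "(\<lambda>n. M n (\<lambda>_. 1)) \<longlonglongrightarrow> I (\<lambda>_. 1)"
      by (simp add: tendsto_eventually)
    show "real (r + 1) * 3 ^ r / c_const r > 0" using c by simp
    show "continuous_on {0..1} f" by (rule f)
    fix y assume y: "y > real (r + 1) * 3 ^ r / c_const r"
    with c have y0: "y > 0" by (smt (verit) divide_pos_pos of_nat_0_le_iff mult_nonneg_nonneg divide_nonneg_pos zero_le_power)
    obtain w where w: "0 < w" "w < 1" "w ^ (r + 1) = c_const r * y * (1 - w)"
      using exists_kernel_parameter[of "c_const r * y" r] c y0 by auto
    let ?H = "real r * w / (real (r + 1) - real r * w)"
    have lim: "(\<lambda>n. 1 / real n * (\<Sum>k=1..r * n. (- y) / (- y - x n k))) \<longlonglongrightarrow> ?H"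
      by (rule zero_kernel_limit[where \<alpha> = \<alpha> and \<beta> = \<beta> and P = P and r = r])
        (use assms P y0 kernel_root_identity[OF r w] in auto)
    have "(\<lambda>n. 1 / real r * (1 / real n * (\<Sum>k=1..r * n. (- y) / (- y - x n k)))) \<longlonglongrightarrow> 1 / real r * ?H"
      by (intro tendsto_mult tendsto_const lim)
    moreover have "1 / real r * (1 / real n * (\<Sum>k=1..r * n. (- y) / (- y - x n k))) = M n (\<lambda>t. y / (y + t))" for n
    proof -
      have "(- y) / (- y - x n k) = y / (y + x n k)" for k
      proof -
        have "- y - x n k = - (y + x n k)" by simp
        then show ?thesis by (simp only: minus_divide_divide)
      qed
      then show ?thesis by (simp add: M_def)
    qed
    moreover have "1 / real r * ?H = I (\<lambda>t. y / (y + t))"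
      unfolding I_def xhat_kernel_mean[OF r w(1,2) y0 w(3) y] using r by simp
    ultimately show "(\<lambda>n. M n (\<lambda>t. y / (y + t))) \<longlonglongrightarrow> I (\<lambda>t. y / (y + t))" by simp
  qed
  then show "(\<lambda>n. 1 / real (r * n) * (\<Sum>k=1..r * n. f (x n k))) \<longlonglongrightarrow> (LBINT t:{0..1}. f t * v_dens r t)"
    unfolding v_dens_integral(1)[OF r f] M_def I_def .
qed

end
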